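(* Let $1<p<+\infty$ and let $T$ be a sublinear operator. Suppose there is a positive increasing function $F$ such that $$\|T\|_{L^{p}(w)\rightarrow L^{p}(w)}\leq F([w]_{A_{p}})$$ for all weights $w\in A_{p}$ on $\mathbb R^n$. Fix a weight $w_{0}\in A_{p}$. Then $$\lim_{d_{*}(w,w_{0})\to0}\|T\|_{L^{p}(w)\rightarrow L^{p}(w)}=\|T\|_{L^{p}(w_{0})\rightarrow L^{p}(w_{0})},$$ that is, for every $\eta>0$ there is $\delta>0$ such that every $w\in A_{p}$ with $d_{*}(w,w_{0})<\delta$ satisfies $\big|\|T\|_{L^{p}(w)\rightarrow L^{p}(w)}-\|T\|_{L^{p}(w_{0})\rightarrow L^{p}(w_{0})}\big|<\eta$.
   Context: A weight is a positive function $w\in L^{1}_{loc}(\mathbb R^n)$. For $1<p<+\infty$, a weight $w$ belongs to $A_{p}$ if its $A_p$ characteristic $$[w]_{A_{p}}:=\sup_{Q}\Big(\frac1{|Q|}\int_{Q}w(x)\,dx\Big)\Big(\frac1{|Q|}\int_{Q}w(x)^{-\frac1{p-1}}\,dx\Big)^{p-1}$$ is finite, where the supremum is over all cubes $Q$ of $\mathbb R^n$. For $f\in L^{1}_{loc}(\mathbb R^n)$, the $BMO(\mathbb R^n)$ norm (modulo constants) is $\|f\|_{*}:=\sup_{Q}\frac1{|Q|}\int_{Q}|f(x)-f_{Q}|\,dx$, where the supremum is over all cubes $Q$ of $\mathbb R^n$ and $f_{Q}=\frac1{|Q|}\int_Q f(x)\,dx$. For $u,v\in A_{p}$ define $d_{*}(u,v):=\|\log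 u-\log v\|_{*}$ (a metric on $A_p$ weights, with weights that differ by a positive multiplicative constant identified). $L^{p}(w)$ is the space of measurable functions $f$ on $\mathbb R^n$ with $\|f\|_{L^p(w)}=\big(\int_{\mathbb R^n}|f(x)|^{p}w(x)\,dx\big)^{1/p}<\infty$, and $\|T\|_{L^{p}(w)\to L^{p}(w)}=\sup\{\|Tf\|_{L^{p}(w)}:\|f\|_{L^{p}(w)}\le 1\}$. An operator $T$, mapping functions in the spaces $L^{p}(w)$, $w\in A_p$, to measurable functions on $\mathbb R^n$ (one and the same $T$ for all $w$), is sublinear if $|T(f+g)|\le|Tf|+|Tg|$ and $|T(cf)|=|c|\,|Tf|$ almost everywhere, for all $f,g$ and scalars $c$ for which the expressions are defined. *)

theory Defs
  imports "HOL-Analysis.Analysis"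
begin

text \<open>Real powers on \<^typ>\<open>ennreal\<close>; only used with exponents \<open>r > 0\<close>, so that
  \<open>\<infinity>\<close> is sent to \<open>\<infinity>\<close> and \<open>0\<close> to \<open>0\<close>.\<close>

definition epowr :: "ennreal \<Rightarrow> real \<Rightarrow> ennreal" where
  "epowr x r = (if x = \<infinity> then \<infinity> else ennreal (enn2real x powr r))"

text \<open>Axis-parallel cubes of positive side length.\<close>

definition cubes :: "(real ^ 'n::finite) set set" where
  "cubes = {cbox a (a + (\<chi> i. l)) | a l. 0 < l}"

definition locally_integrable :: "(real ^ 'n::finite \<Rightarrow> real) \<Rightarrow> bool" where
  "locally_integrable f \<longleftrightarrow> (\<forall>K. compact K \<longrightarrow> f absolutely_integrable_on K)"

definition weight :: "(real ^ 'n::finite \<Rightarrow> real) \<Rightarrow> bool" where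
  "weight w \<longleftrightarrow> (\<forall>x. 0 < w x) \<and> locally_integrable w"

text \<open>Two versions of the mean over a cube: \<open>avg\<close> for nonnegative functions, with value in
  \<open>[0, \<infinity>]\<close>, and \<open>mean\<close> for signed locally integrable ones.\<close>

definition avg :: "(real ^ 'n::finite) set \<Rightarrow> (real ^ 'n \<Rightarrow> ennreal) \<Rightarrow> ennreal" where
  "avg Q f = (\<integral>\<^sup>+ x\<in>Q. f x \<partial>lebesgue) / emeasure lebesgue Q"

definition mean :: "(real ^ 'n::finite) set \<Rightarrow> (real ^ 'n \<Rightarrow> real) \<Rightarrow> real" where
  "mean Q f = (LINT x:Q|lebesgue. f x) / measure lebesgue Q"

definition Ap_char :: "real \<Rightarrow> (real ^ 'n::finite \<Rightarrow> real) \<Rightarrow> ennreal" where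
  "Ap_char p w = (SUP Q\<in>cubes.
     avg Q (\<lambda>x. ennreal (w x)) *
     epowr (avg Q (\<lambda>x. ennreal (w x powr (- 1 / (p - 1))))) (p - 1))"

definition Ap :: "real \<Rightarrow> (real ^ 'n::finite \<Rightarrow> real) set" where
  "Ap p = {w. weight w \<and> Ap_char p w < \<infinity>}"

definition bmo_norm :: "(real ^ 'n::finite \<Rightarrow> real) \<Rightarrow> ennreal" where
  "bmo_norm f = (SUP Q\<in>cubes. avg Q (\<lambda>x. ennreal \<bar>f x - mean Q f\<bar>))"

definition d_star :: "(real ^ 'n::finite \<Rightarrow> real) \<Rightarrow> (real ^ 'n \<Rightarrow> real) \<Rightarrow> ennreal" where
  "d_star u v = bmo_norm (\<lambda>x. ln (u x) - ln (v x))"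

text \<open>The scalar type \<open>'k\<close> ranges over the normed fields containing the reals; its intended
  instances are \<^typ>\<open>real\<close> and \<^typ>\<open>complex\<close>.\<close>

definition Lp_norm ::
  "real \<Rightarrow> (real ^ 'n::finite \<Rightarrow> real) \<Rightarrow>
   (real ^ 'n \<Rightarrow> 'k::{real_normed_field, second_countable_topology}) \<Rightarrow> ennreal" where
  "Lp_norm p w f = epowr (\<integral>\<^sup>+ x. ennreal (norm (f x) powr p * w x) \<partial>lebesgue) (1 / p)"

definition Lp ::
  "real \<Rightarrow> (real ^ 'n::finite \<Rightarrow> real) \<Rightarrow>
   (real ^ 'n \<Rightarrow> 'k::{real_normed_field, second_countable_topology}) set" where
  "Lp p w = {f. f \<in> borel_measurable lebesgue \<and> Lp_norm p w f < \<infinity>}"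

definition op_norm ::
  "real \<Rightarrow> (real ^ 'n::finite \<Rightarrow> real) \<Rightarrow>
   ((real ^ 'n \<Rightarrow> 'k::{real_normed_field, second_countable_topology}) \<Rightarrow> real ^ 'n \<Rightarrow> 'k) \<Rightarrow>
   ennreal" where
  "op_norm p w T = (SUP f\<in>{f \<in> Lp p w. Lp_norm p w f \<le> 1}. Lp_norm p w (T f))"

text \<open>The domain of the operators under consideration: the union of all \<open>L\<^sup>p(w)\<close> with \<open>w \<in> A\<^sub>p\<close>.
  Outside this set the values of an operator are irrelevant.\<close>

definition op_domain ::
  "real \<Rightarrow> (real ^ 'n::finite \<Rightarrow> 'k::{real_normed_field, second_countable_topology}) set" where
  "op_domain p = (\<Union>w\<in>Ap p. Lp p w)"

definition sublinear_operator ::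
  "real \<Rightarrow>
   ((real ^ 'n::finite \<Rightarrow> 'k::{real_normed_field, second_countable_topology}) \<Rightarrow> real ^ 'n \<Rightarrow> 'k) \<Rightarrow>
   bool" where
  "sublinear_operator p T \<longleftrightarrow>
     (\<forall>f\<in>op_domain p. T f \<in> borel_measurable lebesgue) \<and>
     (\<forall>f\<in>op_domain p. \<forall>g\<in>op_domain p. (\<lambda>x. f x + g x) \<in> op_domain p \<longrightarrow>
        (AE x in lebesgue. norm (T (\<lambda>x. f x + g x) x) \<le> norm (T f x) + norm (T g x))) \<and>
     (\<forall>f\<in>op_domain p. \<forall>c. (\<lambda>x. c * f x) \<in> op_domain p \<longrightarrow>
        (AE x in lebesgue. norm (T (\<lambda>x. c * f x) x) = norm c * norm (T f x)))"

end

theory Submission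
  imports Defs
begin

text \<open>Two weights whose logarithms are close in BMO lie on a short piece of a geometric path
  \<open>w0^(1-\<theta>) w1^\<theta>\<close>. If \<open>w = w0 e^h\<close>, then \<open>w = w0^(1-\<theta>) w1^\<theta>\<close> with \<open>w1 = w0 e^(h/\<theta>)\<close>, and
  \<open>w0 = w^(1-\<theta>) w2^\<theta>\<close> with \<open>w2 = w0 e^(-h(1-\<theta>)/\<theta>)\<close>. When \<open>h\<close> is small in BMO compared with \<open>\<theta>\<close>,
  the John--Nirenberg inequality with respect to the \<open>A_\<infinity>\<close> measures \<open>w0\<close> and \<open>w0^(-1/(p-1))\<close> shows that
  \<open>w1\<close> and \<open>w2\<close> are \<open>A_p\<close> weights with characteristic bounded independently of \<open>\<theta>\<close>, so that the
  norm of \<open>T\<close> on their spaces is at most a fixed \<open>K\<close>. Real interpolation with change of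
  measure holds for sublinear operators with the exact bound \<open>M0^(1-\<theta>) M1^\<theta>\<close>, because for a fixed
  exponent \<open>p\<close> the K-functional can be computed pointwise. Hence each of the two norms is at most
  the other one to the power \<open>1-\<theta>\<close> times \<open>K^\<theta>\<close>, and \<open>\<theta>\<close> can be taken arbitrarily small.\<close>

text \<open>Interpolation bounds the norm at an interior point of a path and never bounds an
  endpoint, so one application gives one of the two inequalities; the other makes \<open>w\<close>
  itself an endpoint. Both auxiliary weights are perturbations of the fixed \<open>w0\<close>, never
  of \<open>w\<close>, so one constant depending on \<open>w0\<close> serves every nearby
  \<open>w\<close>. The exact interpolation bound is essential: a factor depending on \<theta> that
  does not tend to 1 would survive the limit \<theta> to 0. Since \<open>T\<close> is only
  sublinear, the argument must use nothing but decompositions of the argument \<open>f\<close>,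
  which is what the K-functional provides. The usual proof that \<open>w e^h\<close> is again an A_p
  weight combines a reverse Hoelder inequality with the unweighted John-Nirenberg inequality.
  Running the stopping-time argument directly in the weighted measure avoids the former: it only
  asks that half of a cube always carries a fixed fraction of the mass, and this follows from
  Hoelder's inequality. One more obstacle is that a norm may vanish, where a ratio of norms is
  meaningless; a positive margin is therefore added before interpolating.\<close>

section \<open>Dyadic cubes and stopping cubes\<close>

text \<open>As a simplification rule it rewrites Lebesgue measures to \<open>lborel\<close> measures of main parts.\<close>

declare emeasure_completion [simp del]

text \<open>Countable additivity of the measure with density \<open>f\<close>. Summing over a family
  by an integral against \<open>count_space\<close> spares an enumeration of the stopping
  cubes.\<close>

lemma set_nn_integral_UN_countable:
  assumes f: "f \<in> borel_measurable M" and c: "countable \<F>" and d: "disjoint \<F>"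
    and m: "\<And>C. C \<in> \<F> \<Longrightarrow> C \<in> sets M"
  shows "(\<integral>\<^sup>+x\<in>\<Union>\<F>. f x \<partial>M) = (\<integral>\<^sup>+C. (\<integral>\<^sup>+x\<in>C. f x \<partial>M) \<partial>count_space \<F>)"
proof -
  have U: "\<Union>\<F> \<in> sets M" using c m by (meson sets.countable_Union subsetI)
  have dj: "disjoint_family_on (\<lambda>C. C) \<F>"
    using d by (auto simp: disjoint_family_on_def disjoint_def)
  have "emeasure (density M f) (\<Union>C\<in>\<F>. C) = (\<integral>\<^sup>+C. emeasure (density M f) C \<partial>count_space \<F>)"
    by (rule emeasure_UN_countable) (use c m dj in auto)
  also have "\<dots> = (\<integral>\<^sup>+C. (\<integral>\<^sup>+x\<in>C. f x \<partial>M) \<partial>count_space \<F>)"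
    by (intro nn_integral_cong) (use m f in \<open>auto simp: emeasure_density\<close>)
  finally show ?thesis using U f by (simp add: emeasure_density)
qed

text \<open>Half-open, so that the dyadic subcubes tile a cube exactly; the closed cubes in
  \<open>cubes\<close> differ from these by null sets.\<close>

definition hcube :: "real ^ 'n::finite \<Rightarrow> real \<Rightarrow> (real ^ 'n) set" where
  "hcube a l = {x. \<forall>i. a $ i \<le> x $ i \<and> x $ i < a $ i + l}"

lemma hcube_bounds:
  "box a (a + (\<chi> i. l)) \<subseteq> hcube a l" "hcube a l \<subseteq> cbox a (a + (\<chi> i. l))"
  by (auto simp: hcube_def mem_box_cart less_imp_le)

lemma hcube_sets [measurable, simp]: "hcube a l \<in> sets lebesgue"
proof -
  have "hcube a l = (\<Inter>i. {x. a $ i \<le> x $ i} \<inter> {x. x $ i < a $ i + l})"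
    by (auto simp: hcube_def)
  also have "\<dots> \<in> sets borel" by measurable
  finally show ?thesis by simp
qed

lemma AE_hcube: "AE x in lebesgue. x \<in> hcube a l \<longleftrightarrow> x \<in> cbox a (a + (\<chi> i. l))"
proof (rule AE_I')
  show "cbox a (a + (\<chi> i. l)) - box a (a + (\<chi> i. l)) \<in> null_sets lebesgue"
    using negligible_frontier_interval negligible_iff_null_sets by blast
qed (use hcube_bounds[of a l] in auto)

lemma set_nn_integral_hcube:
  "(\<integral>\<^sup>+x\<in>hcube a l. f x \<partial>lebesgue) = (\<integral>\<^sup>+x\<in>cbox a (a + (\<chi> i. l)). f x \<partial>lebesgue)"
  by (rule nn_integral_cong_AE) (use AE_hcube in eventually_elim, auto simp: indicator_def)

lemma emeasure_cbox_cube: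
  assumes "0 \<le> l"
  shows "emeasure lebesgue (cbox a (a + (\<chi> i. l)) :: (real ^ 'n::finite) set) = ennreal (l ^ CARD('n))"
proof -
  have ne: "cbox a (a + (\<chi> i. l)) \<noteq> {}"
    using assms by (auto simp: interval_eq_empty_cart not_less)
  have "emeasure lebesgue (cbox a (a + (\<chi> i. l)))
      = ennreal (measure lborel (cbox a (a + (\<chi> i. l))))"
    using emeasure_lborel_cbox_finite[of a "a + (\<chi> i. l)"]
    by (simp add: emeasure_completion emeasure_eq_ennreal_measure less_top)
  also have "measure lborel (cbox a (a + (\<chi> i. l))) = l ^ CARD('n)"
    by (subst content_cbox_cart[OF ne]) simp
  finally show ?thesis .
qed

lemma emeasure_hcube:
  assumes "0 \<le> l"
  shows "emeasure lebesgue (hcube a l :: (real ^ 'n::finite) set) = ennreal (l ^ CARD('n))"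
proof -
  have "emeasure lebesgue (hcube a l) = emeasure lebesgue (cbox a (a + (\<chi> i. l)))"
    by (rule emeasure_eq_AE[OF AE_hcube]) auto
  then show ?thesis using emeasure_cbox_cube[OF assms] by simp
qed

text \<open>Dyadic cubes are equivalence classes of points with equal integer coordinates on the grid of
  width \<open>l/2^k\<close> based at \<open>a\<close>; disjointness and nesting then need no geometry.\<close>

definition dindex :: "real ^ 'n::finite \<Rightarrow> real \<Rightarrow> nat \<Rightarrow> real ^ 'n \<Rightarrow> 'n \<Rightarrow> int" where
  "dindex a l k x i = \<lfloor>2 ^ k * (x $ i - a $ i) / l\<rfloor>"

definition dcube :: "real ^ 'n::finite \<Rightarrow> real \<Rightarrow> nat \<Rightarrow> real ^ 'n \<Rightarrow> (real ^ 'n) set" where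
  "dcube a l k x = {y. dindex a l k y = dindex a l k x}"

lemma dcube_self [simp]: "x \<in> dcube a l k x"
  by (simp add: dcube_def)

text \<open>Passing to the parent cube halves the integer coordinates. Both the floor and
  \<open>div\<close> round downwards, so this is correct for negative coordinates too.\<close>

lemma dindex_Suc: "dindex a l k x i = dindex a l (Suc k) x i div 2"
proof -
  have "\<lfloor>2 * t\<rfloor> div 2 = \<lfloor>t\<rfloor>" for t :: real
    using floor_divide_real_eq_div[of 2 "2 * t"] by simp
  from this[of "2 ^ k * (x $ i - a $ i) / l"] show ?thesis
    by (simp add: dindex_def mult.assoc)
qed

lemma dindex_mono: "j \<le> k \<Longrightarrow> dindex a l k x = dindex a l k y \<Longrightarrow> dindex a l j x = dindex a l j y"
proof (induction k rule: dec_induct)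
  case (step k)
  have "dindex a l k x = dindex a l k y"
    using step.prems dindex_Suc[of a l k] by (metis ext)
  then show ?case using step by simp
qed simp

lemma dcube_memD_le: "y \<in> dcube a l k x \<Longrightarrow> j \<le> k \<Longrightarrow> dcube a l j y = dcube a l j x"
  using dindex_mono[of j k a l y x] by (auto simp: dcube_def)

lemma dcube_antimono: "j \<le> k \<Longrightarrow> dcube a l k x \<subseteq> dcube a l j x"
  using dcube_memD_le dcube_self by blast

lemma dcube_hcube:
  assumes "0 < l"
  shows "dcube a l k x = hcube (\<chi> i. a $ i + l * dindex a l k x i / 2 ^ k) (l / 2 ^ k)"
  using assms
  by (auto simp: dcube_def hcube_def dindex_def fun_eq_iff floor_eq_iff field_simps)

lemma dcube_0: "0 < l \<Longrightarrow> x \<in> hcube a l \<Longrightarrow> dcube a l 0 x = hcube a l"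
proof -
  assume l: "0 < l" and x: "x \<in> hcube a l"
  have "dindex a l 0 x = (\<lambda>_. 0)"
    using x l by (auto simp: dindex_def hcube_def fun_eq_iff floor_eq_iff less_diff_eq diff_less_eq add.commute)
  then show ?thesis using dcube_hcube[OF l, of a 0 x] by simp
qed

lemma dcube_sets [measurable, simp]: "0 < l \<Longrightarrow> dcube a l k x \<in> sets lebesgue"
  by (simp add: dcube_hcube)

lemma emeasure_dcube:
  "0 < l \<Longrightarrow> emeasure lebesgue (dcube a l k x :: (real ^ 'n::finite) set) = ennreal ((l / 2 ^ k) ^ CARD('n))"
  by (simp only: dcube_hcube) (rule emeasure_hcube, simp)

lemma emeasure_dcube_parent:
  assumes "0 < l"
  shows "emeasure lebesgue (dcube a l k x)
     = 2 ^ CARD('n) * emeasure lebesgue (dcube a l (Suc k) x :: (real ^ 'n::finite) set)"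
proof -
  have "(2 :: ennreal) ^ CARD('n) = ennreal (2 ^ CARD('n))"
    using ennreal_power[of 2 "CARD('n)"] by simp
  moreover have "(l / 2 ^ k) ^ CARD('n) = 2 ^ CARD('n) * (l / 2 ^ Suc k) ^ CARD('n)"
    by (simp flip: power_mult_distrib)
  ultimately show ?thesis
    using assms by (simp only: emeasure_dcube[OF assms]) (rule ennreal_mult, auto)
qed

lemma dcube_dist:
  assumes "0 < l" "y \<in> dcube a l k (x :: real ^ 'n::finite)"
  shows "dist y x \<le> real CARD('n) * (l / 2 ^ k)"
proof -
  have "\<bar>(y - x) $ i\<bar> \<le> l / 2 ^ k" for i
  proof -
    have "y \<in> hcube (\<chi> i. a $ i + l * dindex a l k x i / 2 ^ k) (l / 2 ^ k)"
      "x \<in> hcube (\<chi> i. a $ i + l * dindex a l k x i / 2 ^ k) (l / 2 ^ k)"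
      using assms dcube_hcube[OF assms(1), of a k x] dcube_self by blast+
    then show ?thesis unfolding hcube_def by (simp add: abs_le_iff) (smt (verit))
  qed
  then have "(\<Sum>i\<in>UNIV. \<bar>(y - x) $ i\<bar>) \<le> real CARD('n) * (l / 2 ^ k)"
    using sum_bounded_above[of UNIV "\<lambda>i. \<bar>(y - x) $ i\<bar>" "l / 2 ^ k"] by simp
  then show ?thesis using norm_le_l1_cart[of "y - x"] by (simp add: dist_norm)
qed

lemma dcube_subset_open:
  assumes "0 < l" "open U" "x \<in> U"
  shows "\<exists>k. dcube a l k (x :: real ^ 'n::finite) \<subseteq> U"
proof -
  obtain e where e: "0 < e" "\<And>y. dist y x < e \<Longrightarrow> y \<in> U"
    using assms openE by (metis dist_commute mem_ball subset_iff)
  have "0 < e / (real CARD('n) * l)" using e(1) assms(1) by simp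
  then obtain k where "(1 / 2) ^ k < e / (real CARD('n) * l)"
    using real_arch_pow_inv[of _ "1 / 2"] by auto
  then have "real CARD('n) * (l / 2 ^ k) < e"
    using assms(1) by (simp add: field_simps)
  then show ?thesis using dcube_dist[OF assms(1)] e(2) by (meson le_less_trans subsetI)
qed

text \<open>The maximal dyadic cubes with property \<open>P\<close> among those around points of
  \<open>X\<close>: descending from generation 0 towards a point, the first cube that satisfies
  \<open>P\<close> is selected.\<close>

definition stop_cubes ::
  "real ^ 'n::finite \<Rightarrow> real \<Rightarrow> ((real ^ 'n) set \<Rightarrow> bool) \<Rightarrow> (real ^ 'n) set \<Rightarrow> (real ^ 'n) set set" where
  "stop_cubes a l P X =
     {dcube a l k x | k x. x \<in> X \<and> P (dcube a l k x) \<and> (\<forall>j<k. \<not> P (dcube a l j x))}"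

text \<open>A dyadic cube is determined by its generation and its vector of integer coordinates, and
  there are only countably many such pairs.\<close>

lemma countable_stop_cubes: "countable (stop_cubes a l P (X :: (real ^ 'n::finite) set))"
proof -
  have "stop_cubes a l P X \<subseteq> (\<lambda>(k, d). {y. dindex a l k y = d}) ` (UNIV :: (nat \<times> ('n \<Rightarrow> int)) set)"
    by (force simp: stop_cubes_def dcube_def)
  then show ?thesis by (meson countable_image countableI_type countable_subset)
qed

lemma disjoint_stop_cubes: "disjoint (stop_cubes a l P X)"
proof (rule disjointI, rule ccontr)
  fix A B assume A: "A \<in> stop_cubes a l P X" and B: "B \<in> stop_cubes a l P X" and "A \<noteq> B"
    and ne: "A \<inter> B \<noteq> {}"
  obtain k x where kx: "A = dcube a l k x" "P A" "\<And>j. j < k \<Longrightarrow> \<not> P (dcube a l j x)"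
    using A by (auto simp: stop_cubes_def)
  obtain m y where my: "B = dcube a l m y" "P B" "\<And>j. j < m \<Longrightarrow> \<not> P (dcube a l j y)"
    using B by (auto simp: stop_cubes_def)
  obtain z where z: "z \<in> A" "z \<in> B" using ne by blast
  then have zz: "\<And>j. j \<le> k \<Longrightarrow> dcube a l j z = dcube a l j x"
    "\<And>j. j \<le> m \<Longrightarrow> dcube a l j z = dcube a l j y"
    using kx(1) my(1) dcube_memD_le by blast+
  \<comment> \<open>A common point gives both cubes the same ancestors, so a difference in
    generation would provide the deeper cube with an ancestor satisfying \<open>P\<close>.\<close>
  have "\<not> k < m" "\<not> m < k"
    using zz kx my by (metis less_imp_le order_refl)+
  then have "k = m" by simp
  then have "A = B" using zz kx(1) my(1) by (metis order_refl)
  with \<open>A \<noteq> B\<close> show False by simp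
qed

lemma stop_cubes_cover:
  assumes "x \<in> X" "P (dcube a l k x)"
  shows "x \<in> \<Union>(stop_cubes a l P X)"
proof -
  define m where "m = (LEAST k. P (dcube a l k x))"
  have "P (dcube a l m x)" "\<forall>j<m. \<not> P (dcube a l j x)"
    using LeastI[of "\<lambda>k. P (dcube a l k x)", OF assms(2)] not_less_Least
    unfolding m_def by blast+
  then have "dcube a l m x \<in> stop_cubes a l P X"
    using assms(1) unfolding stop_cubes_def by blast
  then show ?thesis by (meson UnionI dcube_self)
qed

lemma stop_cubes_sets: "0 < l \<Longrightarrow> C \<in> stop_cubes a l P X \<Longrightarrow> C \<in> sets lebesgue"
  by (auto simp: stop_cubes_def)

lemma Union_stop_cubes_sets: "0 < l \<Longrightarrow> \<Union>(stop_cubes a l P X) \<in> sets lebesgue"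
  by (meson countable_stop_cubes sets.countable_Union stop_cubes_sets subsetI)

text \<open>A substitute for Lebesgue's differentiation theorem: the set where \<open>f > t > 1\<close> is covered by
  dyadic cubes inside an open set of almost the same measure, and on each of them \<open>f\<close> has mean at
  most 1.\<close>

lemma AE_le_one_of_dyadic_means:
  fixes f :: "real ^ 'n::finite \<Rightarrow> ennreal"
  assumes l: "0 < l" and f [measurable]: "f \<in> borel_measurable lebesgue"
    and G [measurable]: "G \<in> sets lebesgue" and fin: "emeasure lebesgue G < \<infinity>"
    and le: "\<And>x k. x \<in> G \<Longrightarrow> (\<integral>\<^sup>+y\<in>dcube a l k x. f y \<partial>lebesgue) \<le> emeasure lebesgue (dcube a l k x)"
  shows "AE x in lebesgue. x \<in> G \<longrightarrow> f x \<le> 1"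
proof -
  have null: "{x \<in> G. ennreal (1 + 1 / Suc m) \<le> f x} \<in> null_sets lebesgue" for m
  proof -
    define E where "E = {x \<in> G. ennreal (1 + 1 / Suc m) \<le> f x}"
    have Em [measurable]: "E \<in> sets lebesgue"
    proof -
      have "E = G \<inter> {x \<in> space lebesgue. ennreal (1 + 1 / Suc m) \<le> f x}" by (auto simp: E_def)
      also have "\<dots> \<in> sets lebesgue" by measurable
      finally show ?thesis .
    qed
    have Efin: "emeasure lebesgue E < \<infinity>"
      using fin emeasure_mono[of E G lebesgue] by (auto simp: E_def intro: le_less_trans)
    have key: "ennreal (1 + 1 / Suc m) * emeasure lebesgue E \<le> emeasure lebesgue E + ennreal e" if "0 < e" for e
    proof -
      obtain U where U: "open U" "E \<subseteq> U" "U - E \<in> lmeasurable" "emeasure lebesgue (U - E) < ennreal e"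
        using sets_lebesgue_outer_open[OF Em \<open>0 < e\<close>] by blast
      have Um [measurable]: "U \<in> sets lebesgue" using U(1) by simp
      define \<F> where "\<F> = stop_cubes a l (\<lambda>C. C \<subseteq> U) E"
      have cov: "E \<subseteq> \<Union>\<F>"
        unfolding \<F>_def using dcube_subset_open[OF l U(1)] U(2) by (blast intro: stop_cubes_cover)
      have sub: "\<Union>\<F> \<subseteq> U" by (auto simp: \<F>_def stop_cubes_def)
      have Fm: "\<And>C. C \<in> \<F> \<Longrightarrow> C \<in> sets lebesgue" "\<Union>\<F> \<in> sets lebesgue"
        unfolding \<F>_def using l stop_cubes_sets Union_stop_cubes_sets by blast+
      have cd: "countable \<F>" "disjoint \<F>"
        unfolding \<F>_def by (rule countable_stop_cubes disjoint_stop_cubes)+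
      have "ennreal (1 + 1 / Suc m) * emeasure lebesgue E
          = (\<integral>\<^sup>+x. ennreal (1 + 1 / Suc m) * indicator E x \<partial>lebesgue)"
        by (simp add: nn_integral_cmult_indicator)
      also have "\<dots> \<le> (\<integral>\<^sup>+x\<in>\<Union>\<F>. f x \<partial>lebesgue)"
        by (intro nn_integral_mono) (use cov in \<open>auto simp: E_def indicator_def\<close>)
      also have "\<dots> = (\<integral>\<^sup>+C. (\<integral>\<^sup>+x\<in>C. f x \<partial>lebesgue) \<partial>count_space \<F>)"
        by (rule set_nn_integral_UN_countable) (use cd Fm in auto)
      also have "\<dots> \<le> (\<integral>\<^sup>+C. (\<integral>\<^sup>+x\<in>C. 1 \<partial>lebesgue) \<partial>count_space \<F>)"
      proof (rule nn_integral_mono)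
        fix C assume "C \<in> space (count_space \<F>)"
        then have C: "C \<in> \<F>" by simp
        then obtain k x where "C = dcube a l k x" "x \<in> G"
          by (auto simp: \<F>_def stop_cubes_def E_def)
        then show "(\<integral>\<^sup>+x\<in>C. f x \<partial>lebesgue) \<le> (\<integral>\<^sup>+x\<in>C. 1 \<partial>lebesgue)"
          using le Fm(1)[OF C] by simp
      qed
      also have "\<dots> = (\<integral>\<^sup>+x\<in>\<Union>\<F>. 1 \<partial>lebesgue)"
        by (rule set_nn_integral_UN_countable[symmetric]) (use cd Fm in auto)
      also have "\<dots> = emeasure lebesgue (\<Union>\<F>)" using Fm by simp
      also have "\<dots> \<le> emeasure lebesgue (E \<union> (U - E))"
        by (rule emeasure_mono) (use sub in auto)
      also have "\<dots> = emeasure lebesgue E + emeasure lebesgue (U - E)"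
        by (rule plus_emeasure[symmetric]) auto
      also have "\<dots> \<le> emeasure lebesgue E + ennreal e"
        using U(4) by (intro add_left_mono) auto
      finally show ?thesis .
    qed
    define r where "r = measure lebesgue E"
    have r: "emeasure lebesgue E = ennreal r" "0 \<le> r"
      using Efin emeasure_eq_ennreal_measure[of lebesgue E] by (auto simp: r_def less_top)
    have "(1 + 1 / Suc m) * r \<le> r + e" if "0 < e" for e
    proof -
      have "ennreal ((1 + 1 / Suc m) * r) \<le> ennreal (r + e)"
        using key[OF that] that r(2) unfolding r(1) by (subst ennreal_mult, simp_all)
      then show ?thesis using r(2) that by (subst (asm) ennreal_le_iff) auto
    qed
    \<comment> \<open>The measure of the outer open set has been replaced by that of
      \<open>E\<close> up to an arbitrary error; since \<open>E\<close> has finite measure, the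
      excess \<open>r / Suc m\<close> must vanish.\<close>
    then have "(1 + 1 / Suc m) * r \<le> r" by (rule field_le_epsilon)
    then have "r / Suc m \<le> 0" by (simp add: distrib_right)
    then have "r \<le> 0" by (simp add: divide_le_0_iff)
    then have "r = 0" using r by simp
    then have "E \<in> null_sets lebesgue" using r Em by (simp add: null_sets_def)
    then show ?thesis by (simp only: E_def)
  qed
  have "{x \<in> G. \<not> f x \<le> 1} = (\<Union>m. {x \<in> G. ennreal (1 + 1 / Suc m) \<le> f x})" (is "?L = ?R")
  proof safe
    fix x assume "x \<in> G" "\<not> f x \<le> 1"
    then have "1 < f x" by simp
    then obtain t where t: "1 < t" "t < f x" using dense by blast
    then have "t < \<infinity>" using less_le_trans top_greatest by (metis infinity_ennreal_def)
    then obtain s where s: "t = ennreal s" "0 \<le> s" by (cases t) auto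
    then have "1 < s" using t by simp
    then obtain m where m: "1 / Suc m < s - 1" 
      using reals_Archimedean[of "s - 1"] by (auto simp: inverse_eq_divide)
    then have "ennreal (1 + 1 / Suc m) \<le> ennreal s" by (intro ennreal_leI) simp
    then have "ennreal (1 + 1 / Suc m) \<le> f x" using t s by auto
    then show "x \<in> ?R" using \<open>x \<in> G\<close> by auto
  next
    fix x m assume "ennreal (1 + 1 / Suc m) \<le> f x" "f x \<le> 1"
    then have "ennreal (1 + 1 / Suc m) \<le> ennreal 1" by (metis ennreal_1 order_trans)
    then have "(1 + 1 / real (Suc m)) \<le> 1" by (subst (asm) ennreal_le_iff) auto
    then show False by (simp add: divide_le_0_iff)
  qed
  moreover have "?R \<in> null_sets lebesgue" using null by blast
  ultimately show ?thesis by (intro AE_I'[of ?R]) auto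
qed

text \<open>The decomposition at height 1, by stopping at the first dyadic cube whose mean exceeds
  1. The parent of a stopping cube was not selected and has \<open>2 ^ CARD('n)\<close> times its
  measure, whence the upper bound; a point outside all stopping cubes lies only in dyadic cubes of
  mean at most 1.\<close>

lemma calderon_zygmund:
  fixes f :: "real ^ 'n::finite \<Rightarrow> ennreal"
  assumes l: "0 < l" and f [measurable]: "f \<in> borel_measurable lebesgue"
    and Q: "(\<integral>\<^sup>+y\<in>hcube a l. f y \<partial>lebesgue) \<le> emeasure lebesgue (hcube a l)"
  obtains \<F> where "countable \<F>" "disjoint \<F>"
    "\<And>C. C \<in> \<F> \<Longrightarrow> \<exists>b m. 0 < m \<and> C = hcube b m" "\<And>C. C \<in> \<F> \<Longrightarrow> C \<subseteq> hcube a l"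
    "\<And>C. C \<in> \<F> \<Longrightarrow> emeasure lebesgue C \<le> (\<integral>\<^sup>+y\<in>C. f y \<partial>lebesgue)"
    "\<And>C. C \<in> \<F> \<Longrightarrow> (\<integral>\<^sup>+y\<in>C. f y \<partial>lebesgue) \<le> 2 ^ CARD('n) * emeasure lebesgue C"
    "AE x in lebesgue. x \<in> hcube a l - \<Union>\<F> \<longrightarrow> f x \<le> 1"
proof -
  define P where "P C \<longleftrightarrow> emeasure lebesgue C < (\<integral>\<^sup>+y\<in>C. f y \<partial>lebesgue)" for C :: "(real ^ 'n) set"
  define \<F> where "\<F> = stop_cubes a l P (hcube a l)"
  have el: "\<exists>k x. C = dcube a l (Suc k) x \<and> x \<in> hcube a l \<and> P C \<and> \<not> P (dcube a l k x)"
    if C: "C \<in> \<F>" for C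
  proof -
    obtain k x where kx: "C = dcube a l k x" "x \<in> hcube a l" "P C" "\<forall>j<k. \<not> P (dcube a l j x)"
      using C by (auto simp: \<F>_def stop_cubes_def)
    \<comment> \<open>Generation 0 is the starting cube itself, which fails \<open>P\<close> by
      hypothesis, so every stopping cube has a parent inside the starting cube.\<close>
    have "k \<noteq> 0" using kx(1,3) dcube_0[OF l kx(2)] Q by (cases "k = 0") (auto simp: P_def)
    then show ?thesis using kx by (metis lessI not0_implies_Suc)
  qed
  show thesis
  proof
    show "countable \<F>" "disjoint \<F>"
      unfolding \<F>_def by (rule countable_stop_cubes disjoint_stop_cubes)+
    have Um: "\<Union>\<F> \<in> sets lebesgue" unfolding \<F>_def by (rule Union_stop_cubes_sets[OF l])
    fix C assume "C \<in> \<F>"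
    then obtain k x where kx: "C = dcube a l (Suc k) x" "x \<in> hcube a l" "P C" "\<not> P (dcube a l k x)"
      using el by blast
    show "\<exists>b m. 0 < m \<and> C = hcube b m"
      using kx(1) dcube_hcube[OF l] l by (metis divide_pos_pos zero_less_numeral zero_less_power)
    show "C \<subseteq> hcube a l"
      using kx(1) dcube_antimono[of 0 "Suc k" a l x] dcube_0[OF l kx(2)] by simp
    show "emeasure lebesgue C \<le> (\<integral>\<^sup>+y\<in>C. f y \<partial>lebesgue)"
      using kx(3) by (simp add: P_def)
    have "(\<integral>\<^sup>+y\<in>C. f y \<partial>lebesgue) \<le> (\<integral>\<^sup>+y\<in>dcube a l k x. f y \<partial>lebesgue)"
      by (rule nn_integral_mono) (use dcube_antimono[of k "Suc k" a l x] kx(1) in \<open>auto simp: indicator_def\<close>)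
    also have "\<dots> \<le> emeasure lebesgue (dcube a l k x)" using kx(4) by (simp add: P_def)
    also have "\<dots> = 2 ^ CARD('n) * emeasure lebesgue C"
      using emeasure_dcube_parent[OF l] kx(1) by simp
    finally show "(\<integral>\<^sup>+y\<in>C. f y \<partial>lebesgue) \<le> 2 ^ CARD('n) * emeasure lebesgue C" .
  next
    have Um: "\<Union>\<F> \<in> sets lebesgue" unfolding \<F>_def by (rule Union_stop_cubes_sets[OF l])
    show "AE x in lebesgue. x \<in> hcube a l - \<Union>\<F> \<longrightarrow> f x \<le> 1"
    proof (rule AE_le_one_of_dyadic_means[OF l f])
      show "hcube a l - \<Union>\<F> \<in> sets lebesgue" using Um by auto
      have "emeasure lebesgue (hcube a l - \<Union>\<F>) \<le> emeasure lebesgue (hcube a l)"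
        by (rule emeasure_mono) auto
      also have "\<dots> < \<infinity>" using emeasure_hcube[of l a] l by simp
      finally show "emeasure lebesgue (hcube a l - \<Union>\<F>) < \<infinity>" .
      fix x k assume "x \<in> hcube a l - \<Union>\<F>"
      then have "\<not> P (dcube a l k x)" unfolding \<F>_def using stop_cubes_cover by blast
      then show "(\<integral>\<^sup>+y\<in>dcube a l k x. f y \<partial>lebesgue) \<le> emeasure lebesgue (dcube a l k x)"
        by (simp add: P_def)
    qed
  qed
qed

section \<open>A weighted John--Nirenberg inequality\<close>

abbreviation ccube :: "real ^ 'n::finite \<Rightarrow> real \<Rightarrow> (real ^ 'n) set" where
  "ccube a l \<equiv> cbox a (a + (\<chi> i. l))"

lemma emeasure_ccube_pos_finite:
  assumes "0 < l"
  shows "emeasure lebesgue (ccube a l) \<noteq> 0" "emeasure lebesgue (ccube a l) \<noteq> \<infinity>"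
  using assms by (auto simp: emeasure_cbox_cube)

lemma emeasure_hcube_ccube: "0 \<le> l \<Longrightarrow> emeasure lebesgue (hcube a l) = emeasure lebesgue (ccube a l)"
  by (simp add: emeasure_cbox_cube emeasure_hcube)

section \<open>Means over cubes and the BMO norm as inequalities between integrals\<close>

lemma avg_times:
  assumes "0 < l"
  shows "avg (ccube a l) f * emeasure lebesgue (ccube a l) = (\<integral>\<^sup>+x\<in>ccube a l. f x \<partial>lebesgue)"
  unfolding avg_def using emeasure_ccube_pos_finite[OF assms, of a]
  by (simp add: ennreal_divide_times less_top)

lemma avg_leI:
  assumes "0 < l" "(\<integral>\<^sup>+x\<in>ccube a l. f x \<partial>lebesgue) \<le> B * emeasure lebesgue (ccube a l)"
  shows "avg (ccube a l) f \<le> B"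
  using divide_right_mono_ennreal[OF assms(2), of "emeasure lebesgue (ccube a l)"]
    emeasure_ccube_pos_finite[OF assms(1), of a]
  by (simp add: avg_def ennreal_mult_divide_eq)

lemma bmo_norm_integral_le:
  assumes "bmo_norm g \<le> B" "0 < l"
  shows "(\<integral>\<^sup>+x\<in>ccube a l. ennreal \<bar>g x - mean (ccube a l) g\<bar> \<partial>lebesgue) \<le> B * emeasure lebesgue (ccube a l)"
proof -
  have "avg (ccube a l) (\<lambda>x. ennreal \<bar>g x - mean (ccube a l) g\<bar>) \<le> bmo_norm g"
    unfolding bmo_norm_def using assms(2) by (intro SUP_upper) (auto simp: cubes_def)
  then have "avg (ccube a l) (\<lambda>x. ennreal \<bar>g x - mean (ccube a l) g\<bar>) * emeasure lebesgue (ccube a l)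
      \<le> B * emeasure lebesgue (ccube a l)"
    using assms(1) by (intro mult_right_mono) auto
  then show ?thesis by (simp add: avg_times[OF assms(2)])
qed

text \<open>Whatever real value \<open>mean\<close> takes, its default 0 included, \<open>g\<close>
  minus that constant has finite integral over a cube of finite measure. This is how differences of
  logarithms of weights become integrable on cubes.\<close>

lemma bmo_norm_set_integrable:
  fixes g :: "real ^ 'n::finite \<Rightarrow> real"
  assumes [measurable]: "g \<in> borel_measurable lebesgue" and "bmo_norm g < \<infinity>" "0 < l"
  shows "set_integrable lebesgue (ccube a l) g"
proof -
  have [measurable]: "ccube a l \<in> sets lebesgue" by simp
  have "(\<integral>\<^sup>+x\<in>ccube a l. ennreal \<bar>g x - mean (ccube a l) g\<bar> \<partial>lebesgue) < \<infinity>"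
    using bmo_norm_integral_le[OF order_refl assms(3), of g a] assms(2)
      emeasure_ccube_pos_finite[OF assms(3), of a]
    by (simp add: ennreal_mult_less_top less_top) (meson ennreal_mult_less_top less_top order_le_less_trans)
  then have "set_integrable lebesgue (ccube a l) (\<lambda>x. g x - mean (ccube a l) g)"
    unfolding set_integrable_def integrable_iff_bounded
    by (auto simp: nn_integral_set_ennreal[symmetric] abs_mult mult.commute indicator_mult_ennreal)
  then have "set_integrable lebesgue (ccube a l) (\<lambda>x. (g x - mean (ccube a l) g) + mean (ccube a l) g)"
    by (rule set_integral_add) (use emeasure_ccube_pos_finite[OF assms(3), of a] in \<open>auto simp: less_top\<close>)
  then show ?thesis by simp
qed

lemma mean_dist_le:
  fixes g :: "real ^ 'n::finite \<Rightarrow> real"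
  assumes g: "set_integrable lebesgue (ccube a l) g" and l: "0 < l"
    and le: "(\<integral>\<^sup>+x\<in>ccube a l. ennreal \<bar>g x - c\<bar> \<partial>lebesgue) \<le> ennreal B * emeasure lebesgue (ccube a l)"
    and B: "0 \<le> B"
  shows "\<bar>mean (ccube a l) g - c\<bar> \<le> B"
proof -
  define Q where "Q = ccube a l"
  define m where "m = measure lebesgue Q"
  have Qe: "emeasure lebesgue Q = ennreal m" 
    using emeasure_ccube_pos_finite(2)[OF l, of a] unfolding Q_def m_def by (simp add: emeasure_eq_ennreal_measure)
  then have m: "0 < m" using emeasure_ccube_pos_finite(1)[OF l, of a] unfolding Q_def
    by (metis ennreal_eq_0_iff not_less)
  have c: "set_integrable lebesgue Q (\<lambda>x. c)"
    unfolding Q_def using emeasure_ccube_pos_finite[OF l, of a] by (auto simp: less_top)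
  have gc: "set_integrable lebesgue Q (\<lambda>x. g x - c)"
    using g c unfolding Q_def by (rule set_integral_diff)
  have eq: "(LINT x:Q|lebesgue. g x - c) = (LINT x:Q|lebesgue. g x) - c * m"
    using set_integral_diff(2)[OF g[folded Q_def] c] Qe by (simp add: m_def set_integral_const Q_def)
  have "ennreal \<bar>LINT x:Q|lebesgue. g x - c\<bar> \<le> (\<integral>\<^sup>+x. norm (indicator Q x *\<^sub>R (g x - c)) \<partial>lebesgue)"
    using integral_norm_bound_ennreal[OF gc[unfolded set_integrable_def]]
    by (simp add: set_lebesgue_integral_def)
  also have "\<dots> = (\<integral>\<^sup>+x\<in>Q. ennreal \<bar>g x - c\<bar> \<partial>lebesgue)"
    by (intro nn_integral_cong) (auto simp: indicator_def)
  also have "\<dots> \<le> ennreal (B * m)" using le m B by (simp add: Q_def[symmetric] Qe ennreal_mult)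
  finally have "\<bar>(LINT x:Q|lebesgue. g x) - c * m\<bar> \<le> B * m"
    using m B eq by (subst (asm) ennreal_le_iff) auto
  moreover have "mean Q g - c = ((LINT x:Q|lebesgue. g x) - c * m) / m"
    using m by (simp add: mean_def m_def[symmetric] field_simps)
  ultimately show ?thesis using m by (simp add: Q_def[symmetric] abs_divide pos_divide_le_eq)
qed

lemma ennreal_finite_sumE:
  fixes a b c :: ennreal
  assumes "a = b + c" "a < \<infinity>"
  obtains x y where "b = ennreal x" "c = ennreal y" "0 \<le> x" "0 \<le> y" "a = ennreal (x + y)"
proof -
  obtain x y where "b = ennreal x" "c = ennreal y" "0 \<le> x" "0 \<le> y"
    using assms by (cases b; cases c) auto
  then show thesis using assms(1) by (intro that[of x y]) simp_all
qed

text \<open>The A_infinity condition at the single level 1/2, for the measure with density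
  \<open>u\<close>: a set filling half of a cube carries at least the fraction \<open>c\<close> of
  its mass. The level matches the normalisation \<open>1 / 2\<close> of the BMO norm in the
  John-Nirenberg argument. Finite mass on cubes allows masses to be subtracted.\<close>

definition A_infinity :: "real \<Rightarrow> (real ^ 'n::finite \<Rightarrow> ennreal) \<Rightarrow> bool" where
  "A_infinity c u \<longleftrightarrow> (\<forall>a l. 0 < l \<longrightarrow> (\<integral>\<^sup>+x\<in>hcube a l. u x \<partial>lebesgue) < \<infinity> \<and>
     (\<forall>S\<in>sets lebesgue. S \<subseteq> hcube a l \<longrightarrow> emeasure lebesgue (hcube a l) \<le> 2 * emeasure lebesgue S \<longrightarrow>
        ennreal c * (\<integral>\<^sup>+x\<in>hcube a l. u x \<partial>lebesgue) \<le> (\<integral>\<^sup>+x\<in>S. u x \<partial>lebesgue)))"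

text \<open>The induction improves the trivial bound \<open>N\<close> by the factor \<open>r\<close>: outside the stopping cubes
  \<open>g\<close> is within 1 of its mean over \<open>Q\<close>, on each of them its mean has moved by at most \<open>2^n\<close>, and
  together they carry at most the fraction \<open>1 - c\<close> of the mass of \<open>Q\<close>.\<close>

lemma john_nirenberg_truncated:
  fixes u :: "real ^ 'n::finite \<Rightarrow> ennreal" and g :: "real ^ 'n \<Rightarrow> real"
  assumes u [measurable]: "u \<in> borel_measurable lebesgue" and fat: "A_infinity c u"
    and c: "0 \<le> c" "c \<le> 1" and s: "0 \<le> s" and N: "0 \<le> N"
    and r: "r = (1 - c) * exp (s * 2 ^ CARD('n))" "r < 1" and D: "D = exp s / (1 - r)"
    and g [measurable]: "g \<in> borel_measurable lebesgue" and bmo: "bmo_norm g \<le> ennreal (1 / 2)"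
    and l: "0 < l"
  shows "(\<integral>\<^sup>+x\<in>hcube a l. ennreal (min (exp (s * \<bar>g x - mean (ccube a l) g\<bar>)) N) * u x \<partial>lebesgue)
    \<le> ennreal (D + r ^ k * N) * (\<integral>\<^sup>+x\<in>hcube a l. u x \<partial>lebesgue)"
  using l
proof (induction k arbitrary: a l)
  case (0 a l)
  have "0 \<le> D" using D r by simp
  have "(\<integral>\<^sup>+x\<in>hcube a l. ennreal (min (exp (s * \<bar>g x - mean (ccube a l) g\<bar>)) N) * u x \<partial>lebesgue)
    \<le> (\<integral>\<^sup>+x. ennreal (D + N) * (u x * indicator (hcube a l) x) \<partial>lebesgue)"
    using \<open>0 \<le> D\<close> by (intro nn_integral_mono) (auto simp: indicator_def intro!: mult_right_mono ennreal_leI)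
  also have "\<dots> = ennreal (D + N) * (\<integral>\<^sup>+x\<in>hcube a l. u x \<partial>lebesgue)"
    by (rule nn_integral_cmult) simp
  finally show ?case by simp
next
  case (Suc k a l)
  define Q where "Q = hcube a l"
  define m where "m = mean (ccube a l) g"
  define \<phi> where "\<phi> m x = ennreal (min (exp (s * \<bar>g x - m\<bar>)) N)" for m x
  have \<phi>m [measurable]: "\<phi> m \<in> borel_measurable lebesgue" for m unfolding \<phi>_def by measurable
  define U where "U A = (\<integral>\<^sup>+x\<in>A. u x \<partial>lebesgue)" for A
  have Qm [measurable]: "Q \<in> sets lebesgue" by (simp add: Q_def)
  have D0: "0 \<le> D" and r0: "0 \<le> r" using D r c by auto
  have half: "(\<integral>\<^sup>+x\<in>hcube b h. ennreal \<bar>g x - mean (ccube b h) g\<bar> \<partial>lebesgue) \<le> ennreal (1/2) * emeasure lebesgue (hcube b h)"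
    if "0 < h" for b h
    using bmo_norm_integral_le[OF bmo that, of b] that by (simp add: set_nn_integral_hcube emeasure_hcube_ccube)
  have Qfin: "emeasure lebesgue Q < \<infinity>" using Suc.prems by (simp add: Q_def emeasure_hcube)
  have half': "(\<integral>\<^sup>+x\<in>hcube a l. ennreal \<bar>g x - m\<bar> \<partial>lebesgue) \<le> emeasure lebesgue (hcube a l)"
  proof -
    have "ennreal (1/2) * emeasure lebesgue (hcube a l) \<le> ennreal 1 * emeasure lebesgue (hcube a l)"
      by (intro mult_right_mono ennreal_leI) auto
    then show ?thesis using half[OF Suc.prems, of a] by (simp add: m_def)
  qed
  obtain \<F> where F: "countable \<F>" "disjoint \<F>"
    "\<And>C. C \<in> \<F> \<Longrightarrow> \<exists>b m. 0 < m \<and> C = hcube b m" "\<And>C. C \<in> \<F> \<Longrightarrow> C \<subseteq> Q"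
    "\<And>C. C \<in> \<F> \<Longrightarrow> emeasure lebesgue C \<le> (\<integral>\<^sup>+x\<in>C. ennreal \<bar>g x - m\<bar> \<partial>lebesgue)"
    "\<And>C. C \<in> \<F> \<Longrightarrow> (\<integral>\<^sup>+x\<in>C. ennreal \<bar>g x - m\<bar> \<partial>lebesgue) \<le> 2 ^ CARD('n) * emeasure lebesgue C"
    "AE x in lebesgue. x \<in> Q - \<Union>\<F> \<longrightarrow> ennreal \<bar>g x - m\<bar> \<le> 1"
    using calderon_zygmund[OF Suc.prems _ half'] unfolding Q_def by auto
  have Cm: "C \<in> sets lebesgue" if "C \<in> \<F>" for C using F(3)[OF that] by auto
  define V where "V = \<Union>\<F>"
  have Vm [measurable]: "V \<in> sets lebesgue" unfolding V_def using F(1) Cm by (meson sets.countable_Union subsetI)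
  have VQ: "V \<subseteq> Q" using F(4) by (auto simp: V_def)
  \<comment> \<open>Each stopping cube has mean oscillation at least 1, so a BMO norm of at most 1/2
    confines them to half of \<open>Q\<close>. The remaining half is the set to which
    \<open>A_infinity\<close> is applied.\<close>
  have "emeasure lebesgue V = (\<integral>\<^sup>+C. (\<integral>\<^sup>+x\<in>C. 1 \<partial>lebesgue) \<partial>count_space \<F>)"
    using set_nn_integral_UN_countable[of "\<lambda>_. 1" lebesgue \<F>] F(1,2) Cm Vm by (simp add: V_def)
  also have "\<dots> \<le> (\<integral>\<^sup>+C. (\<integral>\<^sup>+x\<in>C. ennreal \<bar>g x - m\<bar> \<partial>lebesgue) \<partial>count_space \<F>)"
    by (rule nn_integral_mono) (use F(5) Cm in simp)
  also have "\<dots> = (\<integral>\<^sup>+x\<in>V. ennreal \<bar>g x - m\<bar> \<partial>lebesgue)"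
    unfolding V_def by (rule set_nn_integral_UN_countable[symmetric]) (use F(1,2) Cm in auto)
  also have "\<dots> \<le> (\<integral>\<^sup>+x\<in>Q. ennreal \<bar>g x - m\<bar> \<partial>lebesgue)"
    by (rule nn_integral_mono) (use VQ in \<open>auto simp: indicator_def\<close>)
  also have "\<dots> \<le> ennreal (1/2) * emeasure lebesgue Q"
    unfolding Q_def m_def by (rule half[OF Suc.prems])
  finally have Vle: "emeasure lebesgue V \<le> ennreal (1/2) * emeasure lebesgue Q" .
  have Qsplit: "emeasure lebesgue Q = emeasure lebesgue (Q - V) + emeasure lebesgue V"
    using plus_emeasure[of "Q - V" lebesgue V] VQ by (simp add: Un_absorb2 Diff_disjoint Int_commute)
  have S2: "emeasure lebesgue Q \<le> 2 * emeasure lebesgue (Q - V)"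
  proof -
    obtain d v where e: "emeasure lebesgue (Q - V) = ennreal d" "emeasure lebesgue V = ennreal v"
      "0 \<le> d" "0 \<le> v" "emeasure lebesgue Q = ennreal (d + v)"
      using ennreal_finite_sumE[OF Qsplit Qfin] by metis
    have "ennreal v \<le> ennreal ((1/2) * (d + v))"
      using Vle e by (subst ennreal_mult) auto
    then have "v \<le> (1/2) * (d + v)" using e by (subst (asm) ennreal_le_iff) auto
    then have "d + v \<le> 2 * d" by simp
    then have "ennreal (d + v) \<le> ennreal (2 * d)" by (rule ennreal_leI)
    then show ?thesis using e by (simp add: ennreal_mult)
  qed
  have UQ: "U Q < \<infinity>" "ennreal c * U Q \<le> U (Q - V)"
    using fat Suc.prems S2 unfolding A_infinity_def U_def Q_def by (blast intro: Diff_subset sets.Diff hcube_sets Vm)+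
  have Usplit: "(\<integral>\<^sup>+x\<in>Q. h x \<partial>lebesgue) = (\<integral>\<^sup>+x\<in>Q - V. h x \<partial>lebesgue) + (\<integral>\<^sup>+x\<in>V. h x \<partial>lebesgue)"
    if "h \<in> borel_measurable lebesgue" for h
    using nn_integral_disjoint_pair[OF that, of "Q - V" V] VQ by (simp add: Un_absorb2 Diff_disjoint Int_commute)
  have UV: "U V \<le> ennreal (1 - c) * U Q"
  proof -
    have Us: "U Q = U (Q - V) + U V" unfolding U_def by (rule Usplit[OF u])
    obtain d v where e: "U (Q - V) = ennreal d" "U V = ennreal v"
      "0 \<le> d" "0 \<le> v" "U Q = ennreal (d + v)"
      using ennreal_finite_sumE[OF Us UQ(1)] by metis
    have "ennreal (c * (d + v)) \<le> ennreal d"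
      using UQ(2) e c by (subst ennreal_mult) auto
    then have "c * (d + v) \<le> d" using e by (subst (asm) ennreal_le_iff) auto
    then have "v \<le> (1 - c) * (d + v)" by (simp add: algebra_simps)
    then have "ennreal v \<le> ennreal ((1 - c) * (d + v))" by (rule ennreal_leI)
    also have "\<dots> = ennreal (1 - c) * ennreal (d + v)" using e c by (subst ennreal_mult) auto
    finally show ?thesis by (simp only: e)
  qed
  define E where "E = ennreal (exp (s * 2 ^ CARD('n)) * (D + r ^ k * N))"
  have outer: "(\<integral>\<^sup>+x\<in>Q - V. \<phi> m x * u x \<partial>lebesgue) \<le> ennreal (exp s) * U Q"
  proof -
    have "(\<integral>\<^sup>+x\<in>Q - V. \<phi> m x * u x \<partial>lebesgue) \<le> (\<integral>\<^sup>+x. ennreal (exp s) * (u x * indicator Q x) \<partial>lebesgue)"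
    proof (rule nn_integral_mono_AE, use F(7) in eventually_elim)
      case (elim x)
      show ?case
      proof (cases "x \<in> Q - V")
        case True
        then have "\<bar>g x - m\<bar> \<le> 1" using elim by (simp add: V_def)
        then have "s * \<bar>g x - m\<bar> \<le> s" using s mult_left_mono[of _ 1 s] by simp
        then have "\<phi> m x \<le> ennreal (exp s)" unfolding \<phi>_def by (intro ennreal_leI) (simp add: min.coboundedI1)
        then show ?thesis using True by (simp add: mult_right_mono)
      qed simp
    qed
    also have "\<dots> = ennreal (exp s) * U Q" unfolding U_def by (rule nn_integral_cmult) simp
    finally show ?thesis .
  qed
  have gfin: "bmo_norm g < \<infinity>" using bmo by (metis ennreal_less_top infinity_ennreal_def le_less_trans)
  have inner: "(\<integral>\<^sup>+x\<in>C. \<phi> m x * u x \<partial>lebesgue) \<le> E * U C" if C: "C \<in> \<F>" for C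
  proof -
    obtain b h where bh: "0 < h" "C = hcube b h" using F(3)[OF C] by blast
    define m' where "m' = mean (ccube b h) g"
    have "(\<integral>\<^sup>+x\<in>ccube b h. ennreal \<bar>g x - m\<bar> \<partial>lebesgue) \<le> ennreal (2 ^ CARD('n)) * emeasure lebesgue (ccube b h)"
      using F(6)[OF C] bh ennreal_power[of 2 "CARD('n)"]
      by (simp add: set_nn_integral_hcube emeasure_hcube_ccube)
    then have mm: "\<bar>m' - m\<bar> \<le> 2 ^ CARD('n)"
      unfolding m'_def using bmo_norm_set_integrable[OF g gfin bh(1)] bh(1) by (intro mean_dist_le) auto
    have pt: "\<phi> m x \<le> ennreal (exp (s * 2 ^ CARD('n))) * \<phi> m' x" for x
    proof -
      have "\<bar>g x - m\<bar> \<le> 2 ^ CARD('n) + \<bar>g x - m'\<bar>" using mm by linarith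
      then have "s * \<bar>g x - m\<bar> \<le> s * 2 ^ CARD('n) + s * \<bar>g x - m'\<bar>"
        using s by (metis mult_left_mono distrib_left)
      then have "exp (s * \<bar>g x - m\<bar>) \<le> exp (s * 2 ^ CARD('n)) * exp (s * \<bar>g x - m'\<bar>)"
        by (simp flip: exp_add)
      \<comment> \<open>The exponential factor is at least 1, so the same truncation level
        \<open>N\<close> can be kept on the subcube.\<close>
      moreover have "N \<le> exp (s * 2 ^ CARD('n)) * N"
        using N s mult_right_mono[of 1 "exp (s * 2 ^ CARD('n))" N] by simp
      ultimately have "min (exp (s * \<bar>g x - m\<bar>)) N \<le> exp (s * 2 ^ CARD('n)) * min (exp (s * \<bar>g x - m'\<bar>)) N"
        by (auto simp: min_def)
      then show ?thesis unfolding \<phi>_def using N by (subst ennreal_mult[symmetric]) (auto intro!: ennreal_leI)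
    qed
    have "(\<integral>\<^sup>+x\<in>C. \<phi> m x * u x \<partial>lebesgue)
        \<le> (\<integral>\<^sup>+x. ennreal (exp (s * 2 ^ CARD('n))) * (\<phi> m' x * u x * indicator C x) \<partial>lebesgue)"
    proof (rule nn_integral_mono)
      fix x show "\<phi> m x * u x * indicator C x \<le> ennreal (exp (s * 2 ^ CARD('n))) * (\<phi> m' x * u x * indicator C x)"
        using mult_right_mono[OF pt[of x], of "u x * indicator C x"] by (simp add: mult.assoc)
    qed
    also have "\<dots> = ennreal (exp (s * 2 ^ CARD('n))) * (\<integral>\<^sup>+x\<in>C. \<phi> m' x * u x \<partial>lebesgue)"
    proof (rule nn_integral_cmult)
      have [measurable]: "C \<in> sets lebesgue" by (rule Cm[OF C])
      show "(\<lambda>x. \<phi> m' x * u x * indicator C x) \<in> borel_measurable lebesgue" by measurable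
    qed
    also have "\<dots> \<le> ennreal (exp (s * 2 ^ CARD('n))) * (ennreal (D + r ^ k * N) * U C)"
      using Suc.IH[OF bh(1), of b] unfolding \<phi>_def U_def m'_def bh(2) by (intro mult_left_mono) auto
    also have "\<dots> = E * U C"
      unfolding E_def using D0 r0 N by (subst ennreal_mult) (auto simp: mult.assoc)
    finally show ?thesis .
  qed
  have "(\<integral>\<^sup>+x\<in>V. \<phi> m x * u x \<partial>lebesgue) = (\<integral>\<^sup>+C. (\<integral>\<^sup>+x\<in>C. \<phi> m x * u x \<partial>lebesgue) \<partial>count_space \<F>)"
    unfolding V_def by (rule set_nn_integral_UN_countable) (use F(1,2) Cm in auto)
  also have "\<dots> \<le> (\<integral>\<^sup>+C. E * U C \<partial>count_space \<F>)"
    by (rule nn_integral_mono) (use inner in simp)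
  also have "\<dots> = E * (\<integral>\<^sup>+C. U C \<partial>count_space \<F>)" by (rule nn_integral_cmult) simp
  also have "\<dots> = E * U V"
    unfolding U_def V_def using set_nn_integral_UN_countable[OF u F(1,2) Cm] by simp
  also have "\<dots> \<le> E * (ennreal (1 - c) * U Q)" by (intro mult_left_mono UV) simp
  also have "\<dots> = ennreal (r * (D + r ^ k * N)) * U Q"
  proof -
    have "E * ennreal (1 - c) = ennreal (exp (s * 2 ^ CARD('n)) * (D + r ^ k * N) * (1 - c))"
      unfolding E_def by (rule ennreal_mult[symmetric]) (use D0 r0 N c in auto)
    then show ?thesis unfolding r(1) by (simp add: mult.assoc[symmetric]) (simp add: mult_ac)
  qed
  finally have "(\<integral>\<^sup>+x\<in>V. \<phi> m x * u x \<partial>lebesgue) \<le> ennreal (r * (D + r ^ k * N)) * U Q" .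
  then have "(\<integral>\<^sup>+x\<in>Q. \<phi> m x * u x \<partial>lebesgue) \<le> ennreal (exp s) * U Q + ennreal (r * (D + r ^ k * N)) * U Q"
    using outer by (subst Usplit) (auto intro: add_mono)
  also have "\<dots> = ennreal (exp s + r * (D + r ^ k * N)) * U Q"
    using D0 r0 N by (subst ennreal_plus) (auto simp: distrib_right)
  \<comment> \<open>\<open>D\<close> is the fixed point of \<open>t \<mapsto> exp s + r * t\<close>;
    hence only the trivial part \<open>r ^ k * N\<close> changes from one step to the next.\<close>
  also have "exp s + r * (D + r ^ k * N) = D + r ^ Suc k * N"
    using D r(2) by (simp add: field_simps)
  finally show ?case by (simp add: \<phi>_def m_def Q_def U_def)
qed

text \<open>The order of the limits matters: for fixed \<open>N\<close> the number of steps
  \<open>k\<close> goes to infinity and removes \<open>r ^ k * N\<close>, and only then is the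
  truncation lifted by monotone convergence. Truncating first makes the induction start from a
  finite bound.\<close>

lemma john_nirenberg_weighted:
  fixes u :: "real ^ 'n::finite \<Rightarrow> ennreal" and g :: "real ^ 'n \<Rightarrow> real"
  assumes u [measurable]: "u \<in> borel_measurable lebesgue" and fat: "A_infinity c u"
    and c: "0 \<le> c" "c \<le> 1" and s: "0 \<le> s"
    and r: "r = (1 - c) * exp (s * 2 ^ CARD('n))" "r < 1"
    and g [measurable]: "g \<in> borel_measurable lebesgue" and bmo: "bmo_norm g \<le> ennreal (1 / 2)"
    and l: "0 < l"
  shows "(\<integral>\<^sup>+x\<in>hcube a l. ennreal (exp (s * \<bar>g x - mean (ccube a l) g\<bar>)) * u x \<partial>lebesgue)
    \<le> ennreal (exp s / (1 - r)) * (\<integral>\<^sup>+x\<in>hcube a l. u x \<partial>lebesgue)"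
proof -
  define D where "D = exp s / (1 - r)"
  define m where "m = mean (ccube a l) g"
  define U where "U = (\<integral>\<^sup>+x\<in>hcube a l. u x \<partial>lebesgue)"
  have r0: "0 \<le> r" using r c by simp
  have D0: "0 \<le> D" using r by (simp add: D_def)
  obtain q where q: "U = ennreal q" "0 \<le> q"
    using fat l unfolding A_infinity_def U_def by (metis ennreal_cases infinity_ennreal_def less_irrefl)
  define f where "f N x = ennreal (min (exp (s * \<bar>g x - m\<bar>)) (real N)) * u x * indicator (hcube a l) x" for N x
  have fN: "(\<integral>\<^sup>+x. f N x \<partial>lebesgue) \<le> ennreal D * U" for N
  proof -
    have k: "(\<integral>\<^sup>+x. f N x \<partial>lebesgue) \<le> ennreal ((D + r ^ k * N) * q)" for k
      using john_nirenberg_truncated[OF u fat c s _ r D_def g bmo l, of "real N" a k] D0 r0 q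
      by (simp add: f_def m_def[symmetric] U_def[symmetric] ennreal_mult)
    have "(\<lambda>k. r ^ k) \<longlonglongrightarrow> 0" using r0 r(2) by (intro LIMSEQ_power_zero) auto
    then have "(\<lambda>k. (D + r ^ k * N) * q) \<longlonglongrightarrow> (D + 0 * real N) * q"
      by (intro tendsto_mult tendsto_add tendsto_const)
    then have "(\<lambda>k. ennreal ((D + r ^ k * N) * q)) \<longlonglongrightarrow> ennreal (D * q)" by (intro tendsto_ennrealI) simp
    then have "(\<integral>\<^sup>+x. f N x \<partial>lebesgue) \<le> ennreal (D * q)" using k by (intro LIMSEQ_le_const) auto
    then show ?thesis using q D0 by (simp add: ennreal_mult)
  qed
  have fm: "f N \<in> borel_measurable lebesgue" for N unfolding f_def by measurable
  have inc: "incseq f"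
    by (auto simp: f_def incseq_def le_fun_def intro!: mult_right_mono ennreal_leI)
  have lim: "ennreal (exp (s * \<bar>g x - m\<bar>)) * u x * indicator (hcube a l) x \<le> (SUP N. f N x)" for x
  proof -
    obtain N where "exp (s * \<bar>g x - m\<bar>) \<le> real N" using real_arch_simple by blast
    then show ?thesis by (intro SUP_upper2[of N]) (auto simp: f_def)
  qed
  have "(\<integral>\<^sup>+x\<in>hcube a l. ennreal (exp (s * \<bar>g x - m\<bar>)) * u x \<partial>lebesgue) \<le> (\<integral>\<^sup>+x. (SUP N. f N x) \<partial>lebesgue)"
    by (intro nn_integral_mono lim)
  also have "\<dots> = (SUP N. \<integral>\<^sup>+x. f N x \<partial>lebesgue)"
    by (rule nn_integral_monotone_convergence_SUP[OF inc fm])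
  also have "\<dots> \<le> ennreal D * U" by (intro SUP_least fN)
  finally show ?thesis by (simp add: D_def U_def m_def)
qed

section \<open>Perturbation of \<open>A_p\<close> weights\<close>

lemma epowr_ennreal [simp]: "0 \<le> x \<Longrightarrow> epowr (ennreal x) r = ennreal (x powr r)"
  by (simp add: epowr_def)

lemma epowr_mono:
  assumes "0 \<le> r" "x \<le> y"
  shows "epowr x r \<le> epowr y r"
proof (cases "y = \<infinity>")
  case False
  then obtain b where b: "y = ennreal b" "0 \<le> b" by (cases y) auto
  then obtain a where a: "x = ennreal a" "0 \<le> a" using assms(2) by (cases x) (auto simp: top_unique)
  show ?thesis using a b assms by (auto intro!: ennreal_leI powr_mono2)
qed (simp add: epowr_def)

lemma weight_measurable:
  fixes w :: "real ^ 'n::finite \<Rightarrow> real"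
  assumes "weight w"
  shows "w \<in> borel_measurable lebesgue"
proof (rule borel_measurable_LIMSEQ_real)
  fix x :: "real ^ 'n"
  obtain N where N: "norm x \<le> real N" using real_arch_simple by blast
  have "\<forall>\<^sub>F k in sequentially. indicator (cball 0 (real k)) x *\<^sub>R w x = w x"
    using eventually_ge_at_top[of N] by eventually_elim (use N in \<open>auto simp: indicator_def\<close>)
  then show "(\<lambda>k. indicator (cball 0 (real k)) x *\<^sub>R w x) \<longlonglongrightarrow> w x" by (rule tendsto_eventually)
next
  fix k :: nat
  have "w absolutely_integrable_on cball 0 (real k)"
    using assms by (simp add: weight_def locally_integrable_def)
  then show "(\<lambda>x. indicator (cball 0 (real k)) x *\<^sub>R w x) \<in> borel_measurable lebesgue"
    unfolding set_integrable_def by (rule borel_measurable_integrable)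
qed

lemma Ap_measurable: "w \<in> Ap p \<Longrightarrow> w \<in> borel_measurable lebesgue"
  by (simp add: Ap_def weight_measurable)

lemma Ap_pos: "w \<in> Ap p \<Longrightarrow> 0 < w x"
  by (simp add: Ap_def weight_def)

lemma absolutely_integrable_on_iff_nn:
  assumes [measurable]: "w \<in> borel_measurable lebesgue" "S \<in> sets lebesgue" and "\<And>x. 0 \<le> w x"
  shows "w absolutely_integrable_on S \<longleftrightarrow> (\<integral>\<^sup>+x\<in>S. ennreal (w x) \<partial>lebesgue) < \<infinity>"
proof -
  have "(\<integral>\<^sup>+x. ennreal (norm (indicator S x *\<^sub>R w x)) \<partial>lebesgue) = (\<integral>\<^sup>+x\<in>S. ennreal (w x) \<partial>lebesgue)"
    by (intro nn_integral_cong) (use assms(3) in \<open>auto simp: indicator_def\<close>)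
  then show ?thesis unfolding set_integrable_def integrable_iff_bounded by simp
qed

lemma compact_subset_ccube:
  fixes K :: "(real ^ 'n::finite) set"
  assumes "compact K"
  shows "\<exists>a l. 0 < l \<and> K \<subseteq> ccube a l"
proof -
  obtain B where B: "0 < B" "\<And>x. x \<in> K \<Longrightarrow> norm x \<le> B"
    using compact_imp_bounded[OF assms] bounded_pos by blast
  have "x \<in> ccube (\<chi> i. - B) (2 * B)" if "x \<in> K" for x
    using B(2)[OF that] component_le_norm_cart[of x] 
    by (auto simp: mem_box_cart) (smt (verit))+
  then show ?thesis using B(1) by (intro exI[of _ "\<chi> i. - B"] exI[of _ "2 * B"]) auto
qed

text \<open>For a nonnegative function cubes exhaust the compact sets, so a perturbed weight only
  has to be controlled on cubes, where the John-Nirenberg estimate lives.\<close>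

lemma locally_integrable_iff_hcube:
  fixes w :: "real ^ 'n::finite \<Rightarrow> real"
  assumes [measurable]: "w \<in> borel_measurable lebesgue" and "\<And>x. 0 \<le> w x"
  shows "locally_integrable w \<longleftrightarrow> (\<forall>a l. 0 < l \<longrightarrow> (\<integral>\<^sup>+x\<in>hcube a l. ennreal (w x) \<partial>lebesgue) < \<infinity>)"
    (is "_ \<longleftrightarrow> ?R")
proof
  assume loc: "locally_integrable w"
  show ?R
  proof (intro allI impI)
    fix a :: "real ^ 'n" and l :: real
    have "w absolutely_integrable_on ccube a l"
      using loc by (simp add: locally_integrable_def)
    then show "(\<integral>\<^sup>+x\<in>hcube a l. ennreal (w x) \<partial>lebesgue) < \<infinity>"
      using absolutely_integrable_on_iff_nn[OF assms(1) _ assms(2), of "ccube a l"]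
      by (simp add: set_nn_integral_hcube)
  qed
next
  assume R: ?R
  show "locally_integrable w" unfolding locally_integrable_def
  proof (intro allI impI)
    fix K :: "(real ^ 'n) set" assume K: "compact K"
    then obtain a l where al: "0 < l" "K \<subseteq> ccube a l" using compact_subset_ccube by blast
    have "w absolutely_integrable_on ccube a l"
      using R al absolutely_integrable_on_iff_nn[OF assms(1) _ assms(2), of "ccube a l"]
      by (simp add: set_nn_integral_hcube)
    moreover have "K \<in> sets lebesgue" using compact_imp_closed[OF K] by simp
    ultimately show "w absolutely_integrable_on K" by (rule set_integrable_subset) (fact al(2))
  qed
qed

section \<open>Hoelder's inequality and the A_p condition on a single cube\<close>

lemma set_nn_integral_pos:
  fixes f :: "real ^ 'n::finite \<Rightarrow> real"
  assumes [measurable]: "f \<in> borel_measurable lebesgue" "S \<in> sets lebesgue" and f: "\<And>x. x \<in> S \<Longrightarrow> 0 < f x"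
    and S: "emeasure lebesgue S \<noteq> 0"
  shows "(\<integral>\<^sup>+x\<in>S. ennreal (f x) \<partial>lebesgue) \<noteq> 0"
proof
  assume "(\<integral>\<^sup>+x\<in>S. ennreal (f x) \<partial>lebesgue) = 0"
  then have "AE x in lebesgue. ennreal (f x) * indicator S x = 0"
    by (subst (asm) nn_integral_0_iff_AE) auto
  then have "AE x in lebesgue. x \<notin> S"
  proof eventually_elim
    case (elim x)
    then show ?case using f[of x] by (auto simp: indicator_def split: if_splits)
  qed
  then have "emeasure lebesgue S = 0" by (subst (asm) AE_iff_measurable[of S]) auto
  then show False using S by simp
qed

text \<open>Hoelder's inequality for \<open>1 = w^(1/p) w^(-1/p)\<close>. It is the converse of the
  A_p inequality and holds on every set of finite measure and masses, so it can be compared with the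
  A_p condition on a larger cube.\<close>

lemma holder_set:
  fixes w :: "real ^ 'n::finite \<Rightarrow> real"
  assumes p: "1 < p" and [measurable]: "w \<in> borel_measurable lebesgue" "S \<in> sets lebesgue"
    and w: "\<And>x. 0 < w x"
    and a: "(\<integral>\<^sup>+x\<in>S. ennreal (w x) \<partial>lebesgue) = ennreal a" "0 \<le> a"
    and b: "(\<integral>\<^sup>+x\<in>S. ennreal (w x powr (- 1 / (p - 1))) \<partial>lebesgue) = ennreal b" "0 \<le> b"
    and v: "emeasure lebesgue S = ennreal v" "0 \<le> v"
  shows "v powr p \<le> a * b powr (p - 1)"
proof (cases "v = 0")
  case True
  then show ?thesis using p a(2) by simp
next
  case False
  then have v0: "0 < v" using v by simp
  have "a \<noteq> 0"
    using set_nn_integral_pos[of w S] w a v v0 by auto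
  moreover have "b \<noteq> 0"
    using set_nn_integral_pos[of "\<lambda>x. w x powr (- 1 / (p - 1))" S] w b v v0
    by (auto simp: less_imp_neq[THEN not_sym])
  ultimately have ab: "0 < a" "0 < b" using a(2) b(2) by auto
  \<comment> \<open>The dilation that balances Young's inequality after integration:
    \<open>t * a\<close> and \<open>k * b\<close> both become \<open>a^(1/p) b^((p-1)/p)\<close>,
    and their weights \<open>1 / p\<close> and \<open>(p - 1) / p\<close> add up to 1.\<close>
  define t where "t = (b / a) powr ((p - 1) / p)"
  have t: "0 < t" using ab by (simp add: t_def)
  define k where "k = t powr (- 1 / (p - 1))"
  have k: "0 < k" using t by (simp add: k_def)
  have pt: "1 \<le> (t / p) * w x + ((p - 1) / p * k) * w x powr (- 1 / (p - 1))" for x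
  proof -
    have tw: "0 < t * w x" using t w by simp
    have "(t * w x) powr (1 / p) * ((t * w x) powr (- 1 / (p - 1))) powr ((p - 1) / p)
        \<le> (1 / p) * (t * w x) + ((p - 1) / p) * (t * w x) powr (- 1 / (p - 1))"
      using p tw by (intro Youngs_inequality_0) (auto simp: field_simps)
    also have "(t * w x) powr (1 / p) * ((t * w x) powr (- 1 / (p - 1))) powr ((p - 1) / p) = 1"
      using p tw w[of x] t by (simp add: powr_powr flip: powr_add)
    finally show ?thesis using t w[of x] by (simp add: powr_mult k_def mult_ac)
  qed
  have "ennreal v = (\<integral>\<^sup>+x\<in>S. 1 \<partial>lebesgue)" using v by simp
  also have "\<dots> \<le> (\<integral>\<^sup>+x. ennreal (t / p) * (ennreal (w x) * indicator S x)
      + ennreal ((p - 1) / p * k) * (ennreal (w x powr (- 1 / (p - 1))) * indicator S x) \<partial>lebesgue)"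
  proof (rule nn_integral_mono)
    fix x
    have "ennreal 1 \<le> ennreal (t / p) * ennreal (w x) + ennreal ((p - 1) / p * k) * ennreal (w x powr (- 1 / (p - 1)))"
      using ennreal_leI[OF pt[of x]] t p w[of x] k
      by (subst ennreal_mult[symmetric], simp, simp)+ (auto simp: ennreal_plus less_imp_le)
    then show "1 * indicator S x \<le> ennreal (t / p) * (ennreal (w x) * indicator S x)
      + ennreal ((p - 1) / p * k) * (ennreal (w x powr (- 1 / (p - 1))) * indicator S x)"
      by (auto simp: indicator_def)
  qed
  also have "\<dots> = ennreal (t / p) * ennreal a + ennreal ((p - 1) / p * k) * ennreal b"
    unfolding a(1)[symmetric] b(1)[symmetric]
    by (subst nn_integral_add) (auto simp: nn_integral_cmult simp del: minus_divide_left)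
  also have "\<dots> = ennreal (t / p * a + (p - 1) / p * k * b)"
  proof -
    have "0 \<le> t / p" "0 \<le> (p - 1) / p * k" using t k p by auto
    then show ?thesis using ab by (simp only: ennreal_mult ennreal_plus mult_nonneg_nonneg less_imp_le)
  qed
  finally have "v \<le> t / p * a + (p - 1) / p * k * b"
    using t k p ab by (subst (asm) ennreal_le_iff) auto
  also have "\<dots> = t * a * (1 / p) + k * b * ((p - 1) / p)" by simp
  also have "t * a = a powr (1 / p) * b powr ((p - 1) / p)"
  proof -
    have "t * a = b powr ((p - 1) / p) * (a powr 1 / a powr ((p - 1) / p))"
      using ab by (simp add: t_def powr_divide)
    also have "a powr 1 / a powr ((p - 1) / p) = a powr (1 - (p - 1) / p)" by (simp add: powr_diff)
    also have "1 - (p - 1) / p = 1 / p" using p by (simp add: field_simps)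
    finally show ?thesis by (simp add: mult.commute)
  qed
  also have "k * b = a powr (1 / p) * b powr ((p - 1) / p)"
  proof -
    have "k = (b / a) powr (- (1 / p))" using p ab by (simp add: k_def t_def powr_powr)
    also have "\<dots> = b powr (- (1 / p)) / a powr (- (1 / p))" using ab by (simp add: powr_divide)
    also have "\<dots> = a powr (1 / p) * b powr (- (1 / p))" by (simp add: powr_minus_divide)
    finally have "k * b = a powr (1 / p) * (b powr (- (1 / p)) * b powr 1)" using ab by simp
    also have "b powr (- (1 / p)) * b powr 1 = b powr (- (1 / p) + 1)" by (simp only: powr_add)
    also have "- (1 / p) + 1 = (p - 1) / p" using p by (simp add: field_simps)
    finally show ?thesis .
  qed
  also have "a powr (1 / p) * b powr ((p - 1) / p) * (1 / p) + a powr (1 / p) * b powr ((p - 1) / p) * ((p - 1) / p)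
      = (a powr (1 / p) * b powr ((p - 1) / p)) * (1 / p + (p - 1) / p)"
    by (simp only: distrib_left)
  also have "1 / p + (p - 1) / p = 1" using p by (simp add: field_simps)
  finally have "v powr p \<le> (a powr (1 / p) * b powr ((p - 1) / p)) powr p"
    using p v by (intro powr_mono2) auto
  also have "\<dots> = a * b powr (p - 1)" using p ab by (simp add: powr_mult powr_powr)
  finally show ?thesis .
qed

text \<open>The A_p condition with denominators cleared and all quantities real. Finiteness of the
  dual mass \<open>b\<close> comes from the characteristic: the mean of \<open>w\<close> is
  positive, so an infinite dual mean would make the product infinite.\<close>

lemma Ap_cube:
  fixes w :: "real ^ 'n::finite \<Rightarrow> real"
  assumes p: "1 < p" and w: "w \<in> Ap p" and l: "0 < l"
  obtains a b v where "0 < a" "0 < b" "0 < v" "emeasure lebesgue (hcube c l) = ennreal v"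
    "(\<integral>\<^sup>+x\<in>hcube c l. ennreal (w x) \<partial>lebesgue) = ennreal a"
    "(\<integral>\<^sup>+x\<in>hcube c l. ennreal (w x powr (- 1 / (p - 1))) \<partial>lebesgue) = ennreal b"
    "a * b powr (p - 1) \<le> enn2real (Ap_char p w) * v powr p"
    "v powr p \<le> a * b powr (p - 1)"
proof -
  note [measurable] = Ap_measurable[OF w]
  have wp: "0 < w x" for x using Ap_pos[OF w] .
  define v where "v = l ^ CARD('n)"
  have v: "0 < v" "emeasure lebesgue (hcube c l) = ennreal v" "emeasure lebesgue (ccube c l) = ennreal v"
    using l by (auto simp: v_def emeasure_hcube emeasure_cbox_cube)
  define B where "B = enn2real (Ap_char p w)"
  have B: "Ap_char p w = ennreal B" using w by (auto simp: Ap_def B_def ennreal_enn2real_if)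
  have "locally_integrable w" using w by (simp add: Ap_def weight_def)
  then have Wfin: "(\<integral>\<^sup>+x\<in>hcube c l. ennreal (w x) \<partial>lebesgue) < \<infinity>"
    using l wp by (subst (asm) locally_integrable_iff_hcube) (auto simp: less_imp_le)
  then obtain a where a: "(\<integral>\<^sup>+x\<in>hcube c l. ennreal (w x) \<partial>lebesgue) = ennreal a" "0 \<le> a"
    by (cases "\<integral>\<^sup>+x\<in>hcube c l. ennreal (w x) \<partial>lebesgue") auto
  have Q0: "emeasure lebesgue (hcube c l) \<noteq> 0" using v by simp
  have a0: "0 < a"
    using set_nn_integral_pos[OF _ _ wp Q0] a by (cases "a = 0") auto
  have chr: "avg (ccube c l) (\<lambda>x. ennreal (w x)) *
     epowr (avg (ccube c l) (\<lambda>x. ennreal (w x powr (- 1 / (p - 1))))) (p - 1) \<le> ennreal B"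
    unfolding B[symmetric] Ap_char_def using l by (intro SUP_upper) (auto simp: cubes_def)
  have avgw: "avg (ccube c l) (\<lambda>x. ennreal (w x)) = ennreal (a / v)"
    unfolding avg_def using a v a0 by (simp add: set_nn_integral_hcube[symmetric] divide_ennreal)
  have "(\<integral>\<^sup>+x\<in>hcube c l. ennreal (w x powr (- 1 / (p - 1))) \<partial>lebesgue) \<noteq> \<infinity>"
  proof
    assume "(\<integral>\<^sup>+x\<in>hcube c l. ennreal (w x powr (- 1 / (p - 1))) \<partial>lebesgue) = \<infinity>"
    then have "avg (ccube c l) (\<lambda>x. ennreal (w x powr (- 1 / (p - 1)))) = \<infinity>"
      unfolding avg_def using v by (simp add: set_nn_integral_hcube[symmetric] ennreal_top_divide)
    then show False using chr avgw a0 v by (simp add: epowr_def ennreal_mult_top top_unique)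
  qed
  then obtain b where b: "(\<integral>\<^sup>+x\<in>hcube c l. ennreal (w x powr (- 1 / (p - 1))) \<partial>lebesgue) = ennreal b" "0 \<le> b"
    by (cases "\<integral>\<^sup>+x\<in>hcube c l. ennreal (w x powr (- 1 / (p - 1))) \<partial>lebesgue") auto
  have wq: "0 < w x powr (- 1 / (p - 1))" for x using wp[of x] by simp
  have b0: "0 < b"
    using set_nn_integral_pos[OF _ _ wq Q0] b by (cases "b = 0") auto
  have avgs: "avg (ccube c l) (\<lambda>x. ennreal (w x powr (- 1 / (p - 1)))) = ennreal (b / v)"
    unfolding avg_def using b v b0 by (simp add: set_nn_integral_hcube[symmetric] divide_ennreal)
  have "ennreal ((a / v) * (b / v) powr (p - 1)) = ennreal (a / v) * epowr (ennreal (b / v)) (p - 1)"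
    using a0 b0 v by (subst ennreal_mult) simp_all
  also have "\<dots> \<le> ennreal B" using chr by (simp only: avgw avgs)
  finally have "ennreal ((a / v) * (b / v) powr (p - 1)) \<le> ennreal B" .
  then have "(a / v) * (b / v) powr (p - 1) \<le> B"
    by (subst (asm) ennreal_le_iff) (auto simp: B_def)
  moreover have "(a / v) * (b / v) powr (p - 1) = a * b powr (p - 1) / v powr p"
    using a0 b0 v p by (simp add: powr_divide powr_diff)
  ultimately have "a * b powr (p - 1) / v powr p \<le> B" by (simp only:)
  then have "a * b powr (p - 1) \<le> B * v powr p" using v by (simp add: pos_divide_le_eq)
  moreover have "v powr p \<le> a * b powr (p - 1)"
    using holder_set[OF p _ _ wp a b v(2)] v by simp
  ultimately show thesis using that a0 b0 v a b B_def by blast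
qed

text \<open>Both bounds of \<open>Ap_cube\<close> on one cube, divided by \<open>v powr p\<close>.
  It places the characteristic in \<open>{1..}\<close>, the range on which the majorant
  \<open>F\<close> is known to be monotone.\<close>

lemma Ap_char_ge_1:
  fixes w :: "real ^ 'n::finite \<Rightarrow> real"
  assumes "1 < p" "w \<in> Ap p"
  shows "1 \<le> enn2real (Ap_char p w)"
proof -
  obtain v where "0 < v" "v powr p \<le> enn2real (Ap_char p w) * v powr p"
    by (rule Ap_cube[OF assms zero_less_one, of 0]) (meson order_trans that)
  then show ?thesis by simp
qed

text \<open>Hoelder on \<open>S\<close> bounds \<open>v powr p\<close> by the masses of
  \<open>S\<close>, at the price of \<open>2 powr p\<close> because \<open>S\<close> fills half of
  the cube; the A_p condition bounds the masses of the cube by \<open>v powr p\<close>. The product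
  of both gives the constant \<open>M\<close>.\<close>

lemma Ap_A_infinity:
  fixes w :: "real ^ 'n::finite \<Rightarrow> real"
  assumes p: "1 < p" and w: "w \<in> Ap p"
  obtains c d where "0 < c" "c \<le> 1" "A_infinity c (\<lambda>x. ennreal (w x))"
    "0 < d" "d \<le> 1" "A_infinity d (\<lambda>x. ennreal (w x powr (- 1 / (p - 1))))"
proof -
  note [measurable] = Ap_measurable[OF w]
  have wp: "0 < w x" for x using Ap_pos[OF w] .
  define M where "M = enn2real (Ap_char p w) * 2 powr p"
  have "1 * 1 \<le> M" unfolding M_def using Ap_char_ge_1[OF p w] p
    by (intro mult_mono ge_one_powr_ge_zero) auto
  then have M: "1 \<le> M" by simp
  define c where "c = 1 / M"
  define d where "d = (1 / M) powr (1 / (p - 1))"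
  have cd: "0 < c" "c \<le> 1" "0 < d" "d \<le> 1"
    using M p by (auto simp: c_def d_def powr_le1)
  have key: "(\<integral>\<^sup>+x\<in>hcube z l. ennreal (w x) \<partial>lebesgue) < \<infinity> \<and>
      (\<integral>\<^sup>+x\<in>hcube z l. ennreal (w x powr (- 1 / (p - 1))) \<partial>lebesgue) < \<infinity> \<and>
     (\<forall>S\<in>sets lebesgue. S \<subseteq> hcube z l \<longrightarrow> emeasure lebesgue (hcube z l) \<le> 2 * emeasure lebesgue S \<longrightarrow>
        ennreal c * (\<integral>\<^sup>+x\<in>hcube z l. ennreal (w x) \<partial>lebesgue) \<le> (\<integral>\<^sup>+x\<in>S. ennreal (w x) \<partial>lebesgue) \<and>
        ennreal d * (\<integral>\<^sup>+x\<in>hcube z l. ennreal (w x powr (- 1 / (p - 1))) \<partial>lebesgue)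
          \<le> (\<integral>\<^sup>+x\<in>S. ennreal (w x powr (- 1 / (p - 1))) \<partial>lebesgue))" if l: "0 < l" for z l
  proof -
    obtain a b v where ab: "0 < a" "0 < b" "0 < v" "emeasure lebesgue (hcube z l) = ennreal v"
      "(\<integral>\<^sup>+x\<in>hcube z l. ennreal (w x) \<partial>lebesgue) = ennreal a"
      "(\<integral>\<^sup>+x\<in>hcube z l. ennreal (w x powr (- 1 / (p - 1))) \<partial>lebesgue) = ennreal b"
      "a * b powr (p - 1) \<le> enn2real (Ap_char p w) * v powr p" "v powr p \<le> a * b powr (p - 1)"
      by (rule Ap_cube[OF p w l, of z]) (rule that)
    have "ennreal c * ennreal a \<le> (\<integral>\<^sup>+x\<in>S. ennreal (w x) \<partial>lebesgue) \<and>
        ennreal d * ennreal b \<le> (\<integral>\<^sup>+x\<in>S. ennreal (w x powr (- 1 / (p - 1))) \<partial>lebesgue)"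
      if S [measurable]: "S \<in> sets lebesgue" and sub: "S \<subseteq> hcube z l"
        and S2: "emeasure lebesgue (hcube z l) \<le> 2 * emeasure lebesgue S" for S
    proof -
      have "(\<integral>\<^sup>+x\<in>S. ennreal (w x) \<partial>lebesgue) \<le> ennreal a"
        unfolding ab(5)[symmetric] by (rule nn_integral_mono) (use sub in \<open>auto simp: indicator_def\<close>)
      then obtain a' where a': "(\<integral>\<^sup>+x\<in>S. ennreal (w x) \<partial>lebesgue) = ennreal a'" "0 \<le> a'" "a' \<le> a"
        using ab(1) by (auto simp: le_ennreal_iff)
      have "(\<integral>\<^sup>+x\<in>S. ennreal (w x powr (- 1 / (p - 1))) \<partial>lebesgue) \<le> ennreal b"
        unfolding ab(6)[symmetric] by (rule nn_integral_mono) (use sub in \<open>auto simp: indicator_def\<close>)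
      then obtain b' where b': "(\<integral>\<^sup>+x\<in>S. ennreal (w x powr (- 1 / (p - 1))) \<partial>lebesgue) = ennreal b'" "0 \<le> b'" "b' \<le> b"
        using ab(2) by (auto simp: le_ennreal_iff)
      have "emeasure lebesgue S \<le> ennreal v" unfolding ab(4)[symmetric] by (rule emeasure_mono[OF sub]) simp
      then obtain s where s: "emeasure lebesgue S = ennreal s" "0 \<le> s"
        using ab(3) by (auto simp: le_ennreal_iff)
      have "ennreal v \<le> ennreal (2 * s)" using S2 s ab(4) by (simp add: ennreal_mult)
      then have "v \<le> 2 * s" using s by (subst (asm) ennreal_le_iff) auto
      then have "v powr p \<le> (2 * s) powr p" using ab(3) p by (intro powr_mono2) auto
      also have "\<dots> = 2 powr p * s powr p" using s by (simp add: powr_mult)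
      also have "\<dots> \<le> 2 powr p * (a' * b' powr (p - 1))"
        using holder_set[OF p _ S wp a'(1,2) b'(1,2) s] by (intro mult_left_mono) auto
      finally have "enn2real (Ap_char p w) * v powr p \<le> enn2real (Ap_char p w) * (2 powr p * (a' * b' powr (p - 1)))"
        by (rule mult_left_mono) simp
      \<comment> \<open>This one inequality is used twice: enlarging \<open>b'\<close> to
        \<open>b\<close> isolates \<open>a'\<close>, and enlarging \<open>a'\<close> to
        \<open>a\<close> isolates \<open>b'\<close>. The second use needs the root of order
        \<open>p - 1\<close>, which explains \<open>d\<close>.\<close>
      then have le: "a * b powr (p - 1) \<le> M * (a' * b' powr (p - 1))"
        using ab(7) by (simp add: M_def mult.assoc)
      have bp: "0 < b powr (p - 1)" using ab(2) by simp
      have "b' powr (p - 1) \<le> b powr (p - 1)" using b' p by (intro powr_mono2) auto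
      then have "M * (a' * b' powr (p - 1)) \<le> M * (a' * b powr (p - 1))"
        using a'(2) M by (intro mult_left_mono) auto
      then have "a * b powr (p - 1) \<le> M * (a' * b powr (p - 1))" using le by (rule order_trans[rotated])
      then have "a \<le> M * a'" using bp by (simp add: mult.assoc[symmetric])
      then have "c * a \<le> a'" using M by (simp add: c_def field_simps)
      have "M * (a' * b' powr (p - 1)) \<le> M * (a * b' powr (p - 1))"
        using a'(3) M by (intro mult_left_mono mult_right_mono) auto
      then have "a * b powr (p - 1) \<le> M * (a * b' powr (p - 1))" using le by (rule order_trans[rotated])
      then have "a * b powr (p - 1) \<le> a * (M * b' powr (p - 1))" by (simp add: mult_ac)
      then have "b powr (p - 1) \<le> M * b' powr (p - 1)" using ab(1) by simp
      then have "(1 / M) * b powr (p - 1) \<le> b' powr (p - 1)" using M by (simp add: field_simps)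
      then have "((1 / M) * b powr (p - 1)) powr (1 / (p - 1)) \<le> (b' powr (p - 1)) powr (1 / (p - 1))"
        using p M by (intro powr_mono2) auto
      then have "d * b \<le> b'" using p M ab(2) b'(2) by (simp add: powr_mult powr_powr d_def powr_divide)
      have "ennreal (c * a) \<le> ennreal a'" "ennreal (d * b) \<le> ennreal b'"
        using \<open>c * a \<le> a'\<close> \<open>d * b \<le> b'\<close> by (auto intro: ennreal_leI)
      then show ?thesis unfolding a'(1) b'(1) using ab(1,2) cd by (simp add: ennreal_mult)
    qed
    then show ?thesis unfolding ab(5,6) by (auto simp del: minus_divide_left)
  qed
  show thesis
    using that[OF cd(1,2) _ cd(3,4)] key unfolding A_infinity_def by blast
qed

section \<open>Exponentials of functions with small BMO norm\<close>

lemma mean_cmult: "mean Q (\<lambda>x. k * f x) = k * mean Q f"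
  by (simp add: mean_def)

lemma bmo_norm_cmult:
  fixes f :: "real ^ 'n::finite \<Rightarrow> real"
  assumes [measurable]: "f \<in> borel_measurable lebesgue"
  shows "bmo_norm (\<lambda>x. k * f x) = ennreal \<bar>k\<bar> * bmo_norm f"
proof -
  have "avg Q (\<lambda>x. ennreal \<bar>k * f x - mean Q (\<lambda>x. k * f x)\<bar>) = ennreal \<bar>k\<bar> * avg Q (\<lambda>x. ennreal \<bar>f x - mean Q f\<bar>)"
    if "Q \<in> cubes" for Q
  proof -
    have [measurable]: "Q \<in> sets lebesgue" using that by (auto simp: cubes_def)
    have "(\<integral>\<^sup>+x\<in>Q. ennreal \<bar>k * f x - k * mean Q f\<bar> \<partial>lebesgue)
        = (\<integral>\<^sup>+x. ennreal \<bar>k\<bar> * (ennreal \<bar>f x - mean Q f\<bar> * indicator Q x) \<partial>lebesgue)"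
      by (intro nn_integral_cong)
        (simp add: ennreal_mult[symmetric] mult.assoc[symmetric] abs_mult[symmetric] right_diff_distrib)
    also have "\<dots> = ennreal \<bar>k\<bar> * (\<integral>\<^sup>+x\<in>Q. ennreal \<bar>f x - mean Q f\<bar> \<partial>lebesgue)"
      by (rule nn_integral_cmult) simp
    finally show ?thesis by (simp add: avg_def mean_cmult ennreal_times_divide)
  qed
  then show ?thesis
    unfolding bmo_norm_def by (simp add: SUP_mult_left_ennreal cong: SUP_cong)
qed

lemma exp_bmo_bound:
  fixes u :: "real ^ 'n::finite \<Rightarrow> ennreal"
  assumes u: "u \<in> borel_measurable lebesgue" and fat: "A_infinity c u" and c: "0 < c" "c \<le> 1"
  obtains e D where "0 < e" "0 < D" "\<And>h a l. h \<in> borel_measurable lebesgue \<Longrightarrow> bmo_norm h \<le> ennreal e \<Longrightarrow> 0 < l \<Longrightarrow>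
    (\<integral>\<^sup>+x\<in>hcube a l. ennreal (exp \<bar>h x - mean (ccube a l) h\<bar>) * u x \<partial>lebesgue)
      \<le> ennreal D * (\<integral>\<^sup>+x\<in>hcube a l. u x \<partial>lebesgue)"
proof -
  \<comment> \<open>Chosen so that \<open>exp (s * 2 ^ CARD('n))\<close> is \<open>1 + c\<close>,
    whence \<open>r\<close> is \<open>(1 - c) (1 + c)\<close>, which is below 1.\<close>
  define s where "s = ln (1 + c) / 2 ^ CARD('n)"
  define r where "r = (1 - c) * exp (s * 2 ^ CARD('n))"
  have s: "0 < s" using c by (simp add: s_def)
  have "r = 1 - c\<^sup>2" using c by (simp add: r_def s_def power2_eq_square algebra_simps)
  then have r: "r < 1" using c by simp
  show thesis
  proof
    \<comment> \<open>With this threshold \<open>h / s\<close> has BMO norm at most 1/2, the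
      normalisation of the John-Nirenberg lemma.\<close>
    show "0 < s / 2" "0 < exp s / (1 - r)" using s r by auto
    fix h :: "real ^ 'n \<Rightarrow> real" and a :: "real ^ 'n" and l :: real
    assume h [measurable]: "h \<in> borel_measurable lebesgue" and bmo: "bmo_norm h \<le> ennreal (s / 2)" and l: "0 < l"
    have "bmo_norm (\<lambda>x. (1 / s) * h x) = ennreal (1 / s) * bmo_norm h"
      using bmo_norm_cmult[OF h, of "1 / s"] s by simp
    also have "\<dots> \<le> ennreal (1 / s) * ennreal (s / 2)" by (intro mult_left_mono bmo) simp
    also have "\<dots> = ennreal (1 / 2)" using s by (simp flip: ennreal_mult)
    finally have b: "bmo_norm (\<lambda>x. (1 / s) * h x) \<le> ennreal (1 / 2)" .
    have "s * \<bar>(1 / s) * h x - mean (ccube a l) (\<lambda>x. (1 / s) * h x)\<bar> = \<bar>h x - mean (ccube a l) h\<bar>" for x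
    proof -
      have "(1 / s) * h x - mean (ccube a l) (\<lambda>x. (1 / s) * h x) = (h x - mean (ccube a l) h) / s"
        by (simp only: mean_cmult) (simp add: diff_divide_distrib)
      then show ?thesis using s by (simp add: abs_divide)
    qed
    then show "(\<integral>\<^sup>+x\<in>hcube a l. ennreal (exp \<bar>h x - mean (ccube a l) h\<bar>) * u x \<partial>lebesgue)
      \<le> ennreal (exp s / (1 - r)) * (\<integral>\<^sup>+x\<in>hcube a l. u x \<partial>lebesgue)"
      using john_nirenberg_weighted[OF u fat _ c(2) _ r_def r _ b l, of a] c s by simp
  qed
qed

lemma set_nn_integral_exp_shift:
  fixes w h :: "real ^ 'n::finite \<Rightarrow> real"
  assumes [measurable]: "w \<in> borel_measurable lebesgue" "h \<in> borel_measurable lebesgue" "S \<in> sets lebesgue"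
    and le: "(\<integral>\<^sup>+x\<in>S. ennreal (exp \<bar>h x - m\<bar>) * ennreal (w x) \<partial>lebesgue) \<le> ennreal D * ennreal a"
    and w: "\<And>x. 0 < w x" and D: "0 \<le> D" "0 \<le> a"
  shows "(\<integral>\<^sup>+x\<in>S. ennreal (w x * exp (h x)) \<partial>lebesgue) \<le> ennreal (exp m * D * a)"
proof -
  have "(\<integral>\<^sup>+x\<in>S. ennreal (w x * exp (h x)) \<partial>lebesgue)
      \<le> (\<integral>\<^sup>+x. ennreal (exp m) * (ennreal (exp \<bar>h x - m\<bar>) * ennreal (w x) * indicator S x) \<partial>lebesgue)"
  proof (rule nn_integral_mono)
    fix x
    have "h x \<le> m + \<bar>h x - m\<bar>" by linarith
    then have "exp (h x) \<le> exp m * exp \<bar>h x - m\<bar>" by (simp flip: exp_add)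
    then have "w x * exp (h x) \<le> exp m * (exp \<bar>h x - m\<bar> * w x)"
      using mult_left_mono[of _ _ "w x"] w[of x] by (simp add: mult_ac less_imp_le)
    then have "ennreal (w x * exp (h x)) \<le> ennreal (exp m) * (ennreal (exp \<bar>h x - m\<bar>) * ennreal (w x))"
      using w[of x] by (simp add: ennreal_leI flip: ennreal_mult)
    then show "ennreal (w x * exp (h x)) * indicator S x
       \<le> ennreal (exp m) * (ennreal (exp \<bar>h x - m\<bar>) * ennreal (w x) * indicator S x)"
      by (auto simp: indicator_def)
  qed
  also have "\<dots> = ennreal (exp m) * (\<integral>\<^sup>+x\<in>S. ennreal (exp \<bar>h x - m\<bar>) * ennreal (w x) \<partial>lebesgue)"
    by (rule nn_integral_cmult) measurable
  also have "\<dots> \<le> ennreal (exp m) * (ennreal D * ennreal a)" by (intro mult_left_mono le) simp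
  also have "\<dots> = ennreal (exp m * D * a)" using D by (simp add: mult.assoc flip: ennreal_mult)
  finally show ?thesis .
qed

text \<open>With \<open>m\<close> the mean of \<open>h\<close>, the mass of the weight gains a
  factor \<open>exp m\<close> and the dual mass a factor \<open>exp (- m / (p - 1))\<close>. They
  cancel in the A_p product, so only the oscillation of \<open>h\<close> counts and one
  \<open>K\<close> serves all admissible \<open>h\<close>.\<close>

lemma Ap_perturbation:
  fixes w :: "real ^ 'n::finite \<Rightarrow> real"
  assumes p: "1 < p" and w: "w \<in> Ap p"
  obtains e K where "0 < e" "\<And>h. h \<in> borel_measurable lebesgue \<Longrightarrow> bmo_norm h \<le> ennreal e \<Longrightarrow>
    (\<lambda>x. w x * exp (h x)) \<in> Ap p \<and> Ap_char p (\<lambda>x. w x * exp (h x)) \<le> ennreal K"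
proof -
  note wm [measurable] = Ap_measurable[OF w]
  have wp: "0 < w x" for x using Ap_pos[OF w] .
  have sp: "0 < w x powr (- 1 / (p - 1))" for x using wp[of x] by simp
  have um: "(\<lambda>x. ennreal (w x)) \<in> borel_measurable lebesgue" by measurable
  have sm: "(\<lambda>x. ennreal (w x powr (- 1 / (p - 1)))) \<in> borel_measurable lebesgue" by measurable
  define B where "B = enn2real (Ap_char p w)"
  obtain c d where cd: "0 < c" "c \<le> 1" "A_infinity c (\<lambda>x. ennreal (w x))"
    "0 < d" "d \<le> 1" "A_infinity d (\<lambda>x. ennreal (w x powr (- 1 / (p - 1))))"
    by (rule Ap_A_infinity[OF p w])
  obtain e1 D1 where 1: "0 < e1" "0 < D1" "\<And>h a l. h \<in> borel_measurable lebesgue \<Longrightarrow> bmo_norm h \<le> ennreal e1 \<Longrightarrow> 0 < l \<Longrightarrow>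
    (\<integral>\<^sup>+x\<in>hcube a l. ennreal (exp \<bar>h x - mean (ccube a l) h\<bar>) * ennreal (w x) \<partial>lebesgue)
      \<le> ennreal D1 * (\<integral>\<^sup>+x\<in>hcube a l. ennreal (w x) \<partial>lebesgue)"
    by (rule exp_bmo_bound[OF um cd(3,1,2)]) (rule that)
  obtain e2 D2 where 2: "0 < e2" "0 < D2" "\<And>h a l. h \<in> borel_measurable lebesgue \<Longrightarrow> bmo_norm h \<le> ennreal e2 \<Longrightarrow> 0 < l \<Longrightarrow>
    (\<integral>\<^sup>+x\<in>hcube a l. ennreal (exp \<bar>h x - mean (ccube a l) h\<bar>) * ennreal (w x powr (- 1 / (p - 1))) \<partial>lebesgue)
      \<le> ennreal D2 * (\<integral>\<^sup>+x\<in>hcube a l. ennreal (w x powr (- 1 / (p - 1))) \<partial>lebesgue)"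
    by (rule exp_bmo_bound[OF sm cd(6,4,5)]) (rule that)
  \<comment> \<open>The dual weight is perturbed by \<open>- h / (p - 1)\<close>, whose BMO norm is
    that of \<open>h\<close> divided by \<open>p - 1\<close>; this accounts for the second
    entry.\<close>
  define e where "e = min e1 (e2 * (p - 1))"
  define K where "K = D1 * D2 powr (p - 1) * B"
  show thesis
  proof (rule that)
    show "0 < e" using 1 2 p by (simp add: e_def)
    fix h :: "real ^ 'n \<Rightarrow> real"
    assume hm [measurable]: "h \<in> borel_measurable lebesgue" and h: "bmo_norm h \<le> ennreal e"
    have h1: "bmo_norm h \<le> ennreal e1"
      using h by (rule order_trans) (auto simp: e_def intro: ennreal_leI)
    define k where "k x = (- 1 / (p - 1)) * h x" for x
    have km [measurable]: "k \<in> borel_measurable lebesgue" unfolding k_def by measurable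
    have "bmo_norm k = ennreal (1 / (p - 1)) * bmo_norm h"
      unfolding k_def using bmo_norm_cmult[OF hm, of "- 1 / (p - 1)"] p by simp
    also have "\<dots> \<le> ennreal (1 / (p - 1)) * ennreal (e2 * (p - 1))"
      by (intro mult_left_mono order_trans[OF h] ennreal_leI) (auto simp: e_def)
    also have "\<dots> = ennreal e2" using p 2 by (simp flip: ennreal_mult)
    finally have k2: "bmo_norm k \<le> ennreal e2" .
    define w' where "w' x = w x * exp (h x)" for x
    have w'm [measurable]: "w' \<in> borel_measurable lebesgue" unfolding w'_def by measurable
    have w'p: "0 < w' x" for x using wp[of x] by (simp add: w'_def)
    have w's: "w' x powr (- 1 / (p - 1)) = w x powr (- 1 / (p - 1)) * exp (k x)" for x
      using wp[of x] by (simp add: w'_def k_def powr_mult powr_def exp_add[symmetric] ln_mult algebra_simps)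
    have cube: "(\<integral>\<^sup>+x\<in>hcube z l. ennreal (w' x) \<partial>lebesgue) < \<infinity> \<and>
        avg (ccube z l) (\<lambda>x. ennreal (w' x)) *
        epowr (avg (ccube z l) (\<lambda>x. ennreal (w' x powr (- 1 / (p - 1))))) (p - 1) \<le> ennreal K"
      if l: "0 < l" for z l
    proof -
      obtain a b v where ab: "0 < a" "0 < b" "0 < v" "emeasure lebesgue (hcube z l) = ennreal v"
        "(\<integral>\<^sup>+x\<in>hcube z l. ennreal (w x) \<partial>lebesgue) = ennreal a"
        "(\<integral>\<^sup>+x\<in>hcube z l. ennreal (w x powr (- 1 / (p - 1))) \<partial>lebesgue) = ennreal b"
        "a * b powr (p - 1) \<le> enn2real (Ap_char p w) * v powr p" "v powr p \<le> a * b powr (p - 1)"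
        by (rule Ap_cube[OF p w l, of z]) (rule that)
      define m where "m = mean (ccube z l) h"
      have mk: "mean (ccube z l) k = - m / (p - 1)"
        unfolding m_def k_def by (simp only: mean_cmult) simp
      have W: "(\<integral>\<^sup>+x\<in>hcube z l. ennreal (w' x) \<partial>lebesgue) \<le> ennreal (exp m * D1 * a)"
        unfolding w'_def m_def
        by (rule set_nn_integral_exp_shift) (use 1(3)[OF hm h1 l, of z] 1(2) ab wp in auto)
      have S: "(\<integral>\<^sup>+x\<in>hcube z l. ennreal (w' x powr (- 1 / (p - 1))) \<partial>lebesgue) \<le> ennreal (exp (- m / (p - 1)) * D2 * b)"
        unfolding w's mk[symmetric]
        by (rule set_nn_integral_exp_shift) (use 2(3)[OF km k2 l, of z, unfolded ab(6)] 2(2) ab(2) sp in auto)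
      have vc: "emeasure lebesgue (ccube z l) = ennreal v" using ab(4) l by (simp add: emeasure_hcube_ccube)
      have "avg (ccube z l) (\<lambda>x. ennreal (w' x)) \<le> ennreal (exp m * D1 * a / v)"
        by (rule avg_leI[OF l]) (use W ab 1 in \<open>simp add: vc set_nn_integral_hcube flip: ennreal_mult\<close>)
      moreover have "avg (ccube z l) (\<lambda>x. ennreal (w' x powr (- 1 / (p - 1)))) \<le> ennreal (exp (- m / (p - 1)) * D2 * b / v)"
        by (rule avg_leI[OF l]) (use S ab 2 in \<open>simp add: vc set_nn_integral_hcube flip: ennreal_mult\<close>)
      then have "epowr (avg (ccube z l) (\<lambda>x. ennreal (w' x powr (- 1 / (p - 1))))) (p - 1)
          \<le> epowr (ennreal (exp (- m / (p - 1)) * D2 * b / v)) (p - 1)"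
        using p by (intro epowr_mono) auto
      ultimately have "avg (ccube z l) (\<lambda>x. ennreal (w' x)) *
        epowr (avg (ccube z l) (\<lambda>x. ennreal (w' x powr (- 1 / (p - 1))))) (p - 1)
        \<le> ennreal (exp m * D1 * a / v) * epowr (ennreal (exp (- m / (p - 1)) * D2 * b / v)) (p - 1)"
        by (rule mult_mono) auto
      also have "\<dots> = ennreal ((exp m * D1 * a / v) * (exp (- m / (p - 1)) * D2 * b / v) powr (p - 1))"
        using 1 2 ab by (subst ennreal_mult) auto
      also have "(exp m * D1 * a / v) * (exp (- m / (p - 1)) * D2 * b / v) powr (p - 1)
          = D1 * D2 powr (p - 1) * (a * b powr (p - 1)) / v powr p"
      proof -
        have "exp (- m / (p - 1)) powr (p - 1) = exp (- m)" using p by (simp add: powr_def)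
        then have "(exp (- m / (p - 1)) * D2 * b / v) powr (p - 1) = exp (- m) * D2 powr (p - 1) * b powr (p - 1) / v powr (p - 1)"
          using 2 ab by (simp add: powr_divide powr_mult)
        moreover have "v * v powr (p - 1) = v powr p" using ab by (simp add: powr_diff)
        ultimately show ?thesis by (simp add: exp_minus field_simps)
      qed
      also have "\<dots> \<le> K"
      proof -
        have "D1 * D2 powr (p - 1) * (a * b powr (p - 1)) \<le> D1 * D2 powr (p - 1) * (B * v powr p)"
          using ab(7) 1 by (intro mult_left_mono) (auto simp: B_def)
        then show ?thesis using ab by (simp add: pos_divide_le_eq K_def mult_ac)
      qed
      finally have "avg (ccube z l) (\<lambda>x. ennreal (w' x)) *
        epowr (avg (ccube z l) (\<lambda>x. ennreal (w' x powr (- 1 / (p - 1))))) (p - 1) \<le> ennreal K"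
        by (simp add: ennreal_leI)
      then show ?thesis using W by (auto intro: le_less_trans)
    qed
    have "Ap_char p w' \<le> ennreal K"
      unfolding Ap_char_def by (rule SUP_least) (use cube in \<open>auto simp: cubes_def\<close>)
    moreover have "weight w'"
      using cube w'p by (simp add: weight_def locally_integrable_iff_hcube less_imp_le)
    ultimately have "w' \<in> Ap p \<and> Ap_char p w' \<le> ennreal K"
      unfolding Ap_def by (auto intro: le_less_trans)
    then show "(\<lambda>x. w x * exp (h x)) \<in> Ap p \<and> Ap_char p (\<lambda>x. w x * exp (h x)) \<le> ennreal K"
      by (simp add: w'_def[abs_def])
  qed
qed

section \<open>Interpolation with change of measure\<close>

text \<open>The pointwise K-functional. Minimising \<open>b^p u + c^p v\<close> over
  \<open>b + c = 1\<close> leads to \<open>b^(p-1) u = c^(p-1) v\<close>, so \<open>b\<close> is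
  proportional to \<open>u^(-1/(p-1))\<close>. For \<open>p = 2\<close> the minimum is
  \<open>u v / (u + v)\<close>.\<close>

definition kfun :: "real \<Rightarrow> real \<Rightarrow> real \<Rightarrow> real" where
  "kfun p u v = (u powr (- 1 / (p - 1)) + v powr (- 1 / (p - 1))) powr (1 - p)"

definition ksplit :: "real \<Rightarrow> real \<Rightarrow> real \<Rightarrow> real" where
  "ksplit p u v = u powr (- 1 / (p - 1)) / (u powr (- 1 / (p - 1)) + v powr (- 1 / (p - 1)))"

lemma powr_dual_exponent:
  fixes u p :: real
  assumes "1 < p" "0 < u"
  shows "(u powr (- 1 / (p - 1))) powr (1 - p) = u"
proof -
  have "(- 1 / (p - 1)) * (1 - p) = 1" using assms by (simp add: field_simps)
  then show ?thesis using assms by (simp add: powr_powr)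
qed

lemma kfun_commute: "kfun p u v = kfun p v u"
  by (simp add: kfun_def add.commute)

lemma kfun_nonneg: "0 \<le> kfun p u v"
  by (simp add: kfun_def)

lemma kfun_pos: "0 < u \<Longrightarrow> 0 < v \<Longrightarrow> 0 < kfun p u v"
  using add_pos_pos[of "u powr (- 1 / (p - 1))" "v powr (- 1 / (p - 1))"] by (simp add: kfun_def)

lemma kfun_le_left:
  assumes "1 < p" "0 < u" "0 < v"
  shows "kfun p u v \<le> u"
proof -
  have "kfun p u v \<le> (u powr (- 1 / (p - 1))) powr (1 - p)"
    unfolding kfun_def using assms by (intro powr_mono2') auto
  then show ?thesis using powr_dual_exponent assms by simp
qed

lemma kfun_le_right: "1 < p \<Longrightarrow> 0 < u \<Longrightarrow> 0 < v \<Longrightarrow> kfun p u v \<le> v"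
  using kfun_le_left kfun_commute by metis

lemma kfun_scale:
  assumes "1 < p" "0 < u" "0 < v" "0 < c"
  shows "kfun p (c * u) (c * v) = c * kfun p u v"
proof -
  have "(c * u) powr (- 1 / (p - 1)) + (c * v) powr (- 1 / (p - 1))
      = c powr (- 1 / (p - 1)) * (u powr (- 1 / (p - 1)) + v powr (- 1 / (p - 1)))"
    using assms by (simp add: powr_mult distrib_left)
  then show ?thesis
    using powr_dual_exponent[OF assms(1,4)] by (simp add: kfun_def powr_mult)
qed

text \<open>The minimum is at most both \<open>u\<close> and \<open>v\<close>. In the interpolation
  this shows that the two pieces of a function in the middle space lie in the endpoint
  spaces.\<close>

lemma kfun_le_geometric_mean:
  assumes "1 < p" "0 < u" "0 < v" "0 < \<theta>" "\<theta> < 1"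
  shows "kfun p u v \<le> u powr (1 - \<theta>) * v powr \<theta>"
proof -
  have "kfun p u v = kfun p u v powr (1 - \<theta>) * kfun p u v powr \<theta>"
    using kfun_pos[OF assms(2,3), of p] by (simp flip: powr_add)
  also have "\<dots> \<le> u powr (1 - \<theta>) * v powr \<theta>"
    using assms kfun_le_left kfun_le_right by (intro mult_mono powr_mono2) (auto simp: kfun_nonneg)
  finally show ?thesis .
qed

lemma ksplit_bounds:
  assumes "0 < u" "0 < v"
  shows "0 < ksplit p u v" "ksplit p u v < 1" "1 - ksplit p u v = ksplit p v u"
proof -
  define a b where "a = u powr (- 1 / (p - 1))" and "b = v powr (- 1 / (p - 1))"
  have "0 < a" "0 < b" using assms by (auto simp: a_def b_def)
  then have "0 < a / (a + b)" "a / (a + b) < 1" "1 - a / (a + b) = b / (b + a)"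
    by (auto simp: field_simps)
  then show "0 < ksplit p u v" "ksplit p u v < 1" "1 - ksplit p u v = ksplit p v u"
    unfolding ksplit_def a_def[symmetric] b_def[symmetric] .
qed

text \<open>The stationarity condition: \<open>b^(p-1) u\<close> equals the minimum itself, and by
  symmetry so does \<open>c^(p-1) v\<close>. Both attainment and minimality rest on it.\<close>

lemma ksplit_powr:
  assumes "1 < p" "0 < u" "0 < v"
  shows "ksplit p u v powr (1 - p) * kfun p u v = u"
proof -
  have "0 < u powr (- 1 / (p - 1)) + v powr (- 1 / (p - 1))" using assms by (simp add: add_pos_pos)
  then show ?thesis
    unfolding ksplit_def kfun_def using powr_dual_exponent[OF assms(1,2)] assms
    by (subst powr_divide) auto
qed

text \<open>\<open>kfun p u v\<close> is the minimum of \<open>b^p u + c^p v\<close> over \<open>b + c = 1\<close>, attained at \<open>b = ksplit p u v\<close>.\<close>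

lemma kfun_attained:
  assumes "1 < p" "0 < u" "0 < v"
  shows "ksplit p u v powr p * u + (1 - ksplit p u v) powr p * v = kfun p u v"
proof -
  have *: "ksplit p a b powr p * a = ksplit p a b * kfun p a b" if "0 < a" "0 < b" for a b
  proof -
    have "ksplit p a b powr p * a = ksplit p a b powr p * ksplit p a b powr (1 - p) * kfun p a b"
      using ksplit_powr[OF assms(1) that] by (simp add: mult.assoc)
    also have "ksplit p a b powr p * ksplit p a b powr (1 - p) = ksplit p a b"
      using ksplit_bounds(1)[OF that, of p] by (simp flip: powr_add)
    finally show ?thesis .
  qed
  show ?thesis
    unfolding *[OF assms(2,3)] *[OF assms(3,2), folded ksplit_bounds(3)[OF assms(2,3)]] kfun_commute[of p v u]
    by (simp add: algebra_simps)
qed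

text \<open>Convexity of the power \<open>p\<close>, with the weights of the optimal splitting. The
  inequality \<open>h \<le> b + c\<close> is the form in which sublinearity enters.\<close>

lemma kfun_le:
  assumes p: "1 < p" and u: "0 < u" and v: "0 < v" and b: "0 \<le> b" and c: "0 \<le> c" and h: "0 \<le> h" "h \<le> b + c"
  shows "h powr p * kfun p u v \<le> b powr p * u + c powr p * v"
proof -
  have "h powr p * kfun p u v \<le> (b + c) powr p * kfun p u v"
    using h p by (intro mult_right_mono powr_mono2) (auto simp: kfun_nonneg)
  also have "\<dots> \<le> b powr p * u + c powr p * v"
  proof (cases "b = 0 \<or> c = 0")
    case True
    have "b powr p * kfun p u v \<le> b powr p * u" "c powr p * kfun p u v \<le> c powr p * v"
      using kfun_le_left[OF p u v] kfun_le_right[OF p u v] by (intro mult_left_mono; simp)+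
    then show ?thesis using True by auto
  next
    case False
    then have bc: "0 < b" "0 < c" using b c by auto
    \<comment> \<open>Writing \<open>b + c\<close> as the convex combination of \<open>b / l\<close>
      and \<open>c / (1 - l)\<close> produces the factors \<open>l powr (1 - p)\<close> and
      \<open>(1 - l) powr (1 - p)\<close>, which \<open>ksplit_powr\<close> turns into
      \<open>u\<close> and \<open>v\<close>.\<close>
    define l where "l = ksplit p u v"
    have l: "0 < l" "l < 1" "1 - l = ksplit p v u" unfolding l_def using ksplit_bounds[OF u v] by auto
    have resc: "t * (x / t) powr p = x powr p * t powr (1 - p)" if "0 < t" "0 < x" for t x :: real
      using that by (simp add: powr_divide powr_diff)
    have "(l *\<^sub>R (b / l) + (1 - l) *\<^sub>R (c / (1 - l))) powr p
        \<le> l * (b / l) powr p + (1 - l) * (c / (1 - l)) powr p"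
      using convex_onD[OF powr_convex[of p], of "1 - l" "b / l" "c / (1 - l)"] l(1,2) bc p by simp
    moreover have "l *\<^sub>R (b / l) + (1 - l) *\<^sub>R (c / (1 - l)) = b + c" using l(1,2) by simp
    ultimately have "(b + c) powr p \<le> b powr p * l powr (1 - p) + c powr p * (1 - l) powr (1 - p)"
      using resc[OF l(1) bc(1)] resc[of "1 - l" c] l(2) bc by simp
    then have "(b + c) powr p * kfun p u v \<le> (b powr p * l powr (1 - p) + c powr p * (1 - l) powr (1 - p)) * kfun p u v"
      by (rule mult_right_mono) (rule kfun_nonneg)
    also have "\<dots> = b powr p * (l powr (1 - p) * kfun p u v) + c powr p * ((1 - l) powr (1 - p) * kfun p u v)"
      by (simp only: distrib_right mult.assoc)
    also have "l powr (1 - p) * kfun p u v = u" unfolding l_def by (rule ksplit_powr[OF p u v])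
    also have "(1 - l) powr (1 - p) * kfun p u v = v"
      unfolding l(3) kfun_commute[of p u v] by (rule ksplit_powr[OF p v u])
    finally show ?thesis .
  qed
  finally show ?thesis .
qed

section \<open>Integrating the K-functional against a power kernel\<close>

lemma kfun_measurable [measurable]:
  assumes [measurable]: "f \<in> borel_measurable M" "g \<in> borel_measurable M"
  shows "(\<lambda>x. kfun p (f x) (g x)) \<in> borel_measurable M" "(\<lambda>x. ksplit p (f x) (g x)) \<in> borel_measurable M"
  unfolding kfun_def ksplit_def by measurable

text \<open>The normalising constant of the real method with measure \<open>ds / s\<close>. It
  occurs on both sides of the integrated inequality and is cancelled there, for which it has to be
  positive and finite.\<close>

definition kconst :: "real \<Rightarrow> real \<Rightarrow> ennreal" where
  "kconst p \<theta> = (\<integral>\<^sup>+s\<in>{0<..}. ennreal (s powr (- \<theta> - 1) * kfun p 1 s) \<partial>lborel)"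

text \<open>Near 0 the bound \<open>kfun p 1 s \<le> s\<close> leaves
  \<open>s powr (- \<theta>)\<close>, and near infinity \<open>kfun p 1 s \<le> 1\<close> leaves
  \<open>s powr (- \<theta> - 1)\<close>; both are integrable for \<theta> strictly between 0 and
  1.\<close>

lemma kconst_finite:
  assumes "1 < p" "0 < \<theta>" "\<theta> < 1"
  shows "kconst p \<theta> < \<infinity>"
proof -
  have "((\<lambda>s. s powr (- \<theta>)) has_integral (1 powr (- \<theta> + 1) / (- \<theta> + 1))) {0..1}"
    using assms by (intro has_integral_powr_from_0) auto
  then have I1: "(\<integral>\<^sup>+s\<in>{0..1}. ennreal (s powr (- \<theta>)) \<partial>lborel) < \<infinity>"
    by (subst nn_integral_has_integral_lebesgue') auto
  have "((\<lambda>s. s powr (- \<theta> - 1)) has_integral - (1 powr (- \<theta> - 1 + 1)) / (- \<theta> - 1 + 1)) {1..}"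
    using assms by (intro has_integral_powr_to_inf) auto
  then have I2: "(\<integral>\<^sup>+s\<in>{1..}. ennreal (s powr (- \<theta> - 1)) \<partial>lborel) < \<infinity>"
    by (subst nn_integral_has_integral_lebesgue') auto
  have "kconst p \<theta> \<le> (\<integral>\<^sup>+s. ennreal (s powr (- \<theta>)) * indicator {0..1} s + ennreal (s powr (- \<theta> - 1)) * indicator {1..} s \<partial>lborel)"
    unfolding kconst_def
  proof (rule nn_integral_mono)
    fix s :: real
    show "ennreal (s powr (- \<theta> - 1) * kfun p 1 s) * indicator {0<..} s
      \<le> ennreal (s powr (- \<theta>)) * indicator {0..1} s + ennreal (s powr (- \<theta> - 1)) * indicator {1..} s"
    proof (cases "0 < s")
      case True
      have 1: "s powr (- \<theta> - 1) * kfun p 1 s \<le> s powr (- \<theta> - 1) * 1"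
        using assms True by (intro mult_left_mono kfun_le_left) auto
      have "s powr (- \<theta> - 1) * kfun p 1 s \<le> s powr (- \<theta> - 1) * s powr 1"
        using assms True by (intro mult_left_mono) (auto intro: kfun_le_right)
      also have "\<dots> = s powr (- \<theta> - 1 + 1)" by (simp only: powr_add)
      finally have 2: "s powr (- \<theta> - 1) * kfun p 1 s \<le> s powr (- \<theta>)" by simp
      show ?thesis
      proof (cases "s \<le> 1")
        case le: True
        have "ennreal (s powr (- \<theta> - 1) * kfun p 1 s) * indicator {0<..} s \<le> ennreal (s powr (- \<theta>)) * indicator {0..1} s"
          using 2 True le by (simp add: ennreal_leI)
        then show ?thesis by (rule order_trans) simp
      next
        case gt: False
        have "ennreal (s powr (- \<theta> - 1) * kfun p 1 s) * indicator {0<..} s \<le> ennreal (s powr (- \<theta> - 1)) * indicator {1..} s"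
          using 1 True gt by (simp add: ennreal_leI)
        then show ?thesis by (rule order_trans) simp
      qed
    qed simp
  qed
  also have "\<dots> = (\<integral>\<^sup>+s\<in>{0..1}. ennreal (s powr (- \<theta>)) \<partial>lborel) + (\<integral>\<^sup>+s\<in>{1..}. ennreal (s powr (- \<theta> - 1)) \<partial>lborel)"
    by (rule nn_integral_add) auto
  also have "\<dots> < \<infinity>" using I1 I2 by simp
  finally show ?thesis .
qed

lemma kconst_pos: "kconst p \<theta> \<noteq> 0"
proof
  assume "kconst p \<theta> = 0"
  then have "AE s in lborel. ennreal (s powr (- \<theta> - 1) * kfun p 1 s) * indicator {0<..} s = 0"
    unfolding kconst_def by (subst (asm) nn_integral_0_iff_AE) auto
  then have "AE s in lborel. s \<notin> {0<..<1::real}"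
  proof eventually_elim
    case (elim s)
    show ?case
    proof
      assume s: "s \<in> {0<..<1}"
      then have "0 < s powr (- \<theta> - 1) * kfun p 1 s" by (auto intro!: mult_pos_pos kfun_pos)
      then show False using elim s by simp
    qed
  qed
  then have "emeasure lborel {0<..<1::real} = 0"
    by (subst (asm) AE_iff_measurable[of "{0<..<1}"]) auto
  then show False by simp
qed

text \<open>The substitution \<open>s = (u / v) r\<close> and homogeneity of \<open>kfun\<close>
  separate the variables. This is where the geometric mean of the weights comes from.\<close>

lemma nn_integral_kfun:
  assumes p: "1 < p" and u: "0 < u" and v: "0 < v"
  shows "(\<integral>\<^sup>+s\<in>{0<..}. ennreal (s powr (- \<theta> - 1) * kfun p u (s * v)) \<partial>lborel)
    = kconst p \<theta> * ennreal (u powr (1 - \<theta>) * v powr \<theta>)"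
proof -
  define c where "c = u / v"
  have c: "0 < c" using u v by (simp add: c_def)
  have "(\<integral>\<^sup>+s\<in>{0<..}. ennreal (s powr (- \<theta> - 1) * kfun p u (s * v)) \<partial>lborel)
      = ennreal \<bar>c\<bar> * (\<integral>\<^sup>+r. ennreal ((0 + c * r) powr (- \<theta> - 1) * kfun p u ((0 + c * r) * v)) * indicator {0<..} (0 + c * r) \<partial>lborel)"
    using c by (intro nn_integral_real_affine) auto
  also have "\<dots> = ennreal \<bar>c\<bar> * (\<integral>\<^sup>+r. ennreal (c powr (- \<theta> - 1) * u) * (ennreal (r powr (- \<theta> - 1) * kfun p 1 r) * indicator {0<..} r) \<partial>lborel)"
  proof -
    have "ennreal ((0 + c * r) powr (- \<theta> - 1) * kfun p u ((0 + c * r) * v)) * indicator {0<..} (0 + c * r)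
      = ennreal (c powr (- \<theta> - 1) * u) * (ennreal (r powr (- \<theta> - 1) * kfun p 1 r) * indicator {0<..} r)" for r
    proof (cases "0 < r")
      case True
      have "(0 + c * r) * v = u * r" using v by (simp add: c_def)
      then have "(0 + c * r) powr (- \<theta> - 1) * kfun p u ((0 + c * r) * v)
          = (c powr (- \<theta> - 1) * u) * (r powr (- \<theta> - 1) * kfun p 1 r)"
        using kfun_scale[OF p _ True u, of 1] c True by (simp only: powr_mult add_0 mult_1_right zero_less_one simp_thms) (simp add: mult_ac)
      then show ?thesis using True c u by (simp add: ennreal_mult kfun_nonneg)
    qed (use c in \<open>simp add: zero_less_mult_iff\<close>)
    then show ?thesis by (simp only:)
  qed
  also have "\<dots> = ennreal \<bar>c\<bar> * (ennreal (c powr (- \<theta> - 1) * u) * kconst p \<theta>)"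
    unfolding kconst_def by (subst nn_integral_cmult) auto
  also have "\<dots> = kconst p \<theta> * ennreal (c * (c powr (- \<theta> - 1) * u))"
    using c u by (simp add: ennreal_mult mult_ac)
  also have "c * (c powr (- \<theta> - 1) * u) = u powr (1 - \<theta>) * v powr \<theta>"
  proof -
    have "c * (c powr (- \<theta> - 1) * u) = c powr (- \<theta>) * u" using c by (simp add: powr_diff)
    also have "c powr (- \<theta>) = u powr (- \<theta>) * v powr \<theta>"
      unfolding c_def using u v by (simp add: powr_divide powr_minus_divide)
    finally show ?thesis using u by (simp add: powr_diff powr_minus_divide)
  qed
  finally show ?thesis .
qed

lemma sigma_finite_lebesgue: "sigma_finite_measure (lebesgue :: 'a::euclidean_space measure)"
proof
  obtain A :: "'a set set" where A: "countable A" "A \<subseteq> sets lborel" "\<Union>A = space lborel" "\<forall>a\<in>A. emeasure lborel a \<noteq> \<infinity>"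
    using lborel.sigma_finite_countable by blast
  have "emeasure lebesgue a \<noteq> \<infinity> \<and> a \<in> sets lebesgue" if "a \<in> A" for a
    using A(2,4) that sets_completionI_sets[of a lborel] by (auto simp: emeasure_completion)
  then show "\<exists>A::'a set set. countable A \<and> A \<subseteq> sets lebesgue \<and> \<Union>A = space lebesgue \<and> (\<forall>a\<in>A. emeasure lebesgue a \<noteq> \<infinity>)"
    using A(1,3) by (intro exI[of _ A] conjI ballI subsetI) simp_all
qed

lemma nn_integral_kfun_swap:
  fixes g a b :: "'a::euclidean_space \<Rightarrow> real"
  assumes [measurable]: "g \<in> borel_measurable lebesgue" "a \<in> borel_measurable lebesgue" "b \<in> borel_measurable lebesgue"
    and p: "1 < p" and nn: "\<And>x. 0 \<le> g x" and ab: "\<And>x. 0 < a x" "\<And>x. 0 < b x"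
  shows "(\<integral>\<^sup>+s\<in>{0<..}. ennreal (s powr (- \<theta> - 1)) * (\<integral>\<^sup>+x. ennreal (g x * kfun p (a x) (s * b x)) \<partial>lebesgue) \<partial>lborel)
    = kconst p \<theta> * (\<integral>\<^sup>+x. ennreal (g x * (a x powr (1 - \<theta>) * b x powr \<theta>)) \<partial>lebesgue)"
proof -
  interpret L: sigma_finite_measure "lebesgue :: 'a measure" by (rule sigma_finite_lebesgue)
  interpret pair_sigma_finite "lborel :: real measure" "lebesgue :: 'a measure" ..
  define f where "f s x = ennreal (g x) * (ennreal (s powr (- \<theta> - 1) * kfun p (a x) (s * b x)) * indicator {0<..} s)" for s x
  have fm [measurable]: "case_prod f \<in> borel_measurable (lborel \<Otimes>\<^sub>M lebesgue)"
    unfolding f_def by measurable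
  have "(\<integral>\<^sup>+s\<in>{0<..}. ennreal (s powr (- \<theta> - 1)) * (\<integral>\<^sup>+x. ennreal (g x * kfun p (a x) (s * b x)) \<partial>lebesgue) \<partial>lborel)
      = (\<integral>\<^sup>+s. (\<integral>\<^sup>+x. f s x \<partial>lebesgue) \<partial>lborel)"
  proof (rule nn_integral_cong)
    fix s :: real
    show "ennreal (s powr (- \<theta> - 1)) * (\<integral>\<^sup>+x. ennreal (g x * kfun p (a x) (s * b x)) \<partial>lebesgue) * indicator {0<..} s
      = (\<integral>\<^sup>+x. f s x \<partial>lebesgue)"
    proof (cases "0 < s")
      case True
      have "f s x = ennreal (s powr (- \<theta> - 1)) * ennreal (g x * kfun p (a x) (s * b x))" for x
        using True nn[of x] by (simp add: f_def mult_ac kfun_nonneg flip: ennreal_mult)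
      then show ?thesis using True by (simp add: nn_integral_cmult)
    qed (simp add: f_def)
  qed
  also have "\<dots> = (\<integral>\<^sup>+x. (\<integral>\<^sup>+s. f s x \<partial>lborel) \<partial>lebesgue)" by (rule Fubini'[symmetric, OF fm])
  also have "\<dots> = (\<integral>\<^sup>+x. kconst p \<theta> * ennreal (g x * (a x powr (1 - \<theta>) * b x powr \<theta>)) \<partial>lebesgue)"
  proof (rule nn_integral_cong)
    fix x
    have "(\<integral>\<^sup>+s. f s x \<partial>lborel) = ennreal (g x) * (\<integral>\<^sup>+s\<in>{0<..}. ennreal (s powr (- \<theta> - 1) * kfun p (a x) (s * b x)) \<partial>lborel)"
      unfolding f_def by (rule nn_integral_cmult) measurable
    also have "\<dots> = ennreal (g x) * (kconst p \<theta> * ennreal (a x powr (1 - \<theta>) * b x powr \<theta>))"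
      by (subst nn_integral_kfun[OF p ab]) simp
    finally show "(\<integral>\<^sup>+s. f s x \<partial>lborel) = kconst p \<theta> * ennreal (g x * (a x powr (1 - \<theta>) * b x powr \<theta>))"
      using nn[of x] by (simp add: ennreal_mult mult_ac)
  qed
  also have "\<dots> = kconst p \<theta> * (\<integral>\<^sup>+x. ennreal (g x * (a x powr (1 - \<theta>) * b x powr \<theta>)) \<partial>lebesgue)"
    by (rule nn_integral_cmult) measurable
  finally show ?thesis .
qed

section \<open>Weighted norms and operator norms as integral inequalities\<close>

lemma Lp_norm_finite_iff:
  "Lp_norm p w f < \<infinity> \<longleftrightarrow> (\<integral>\<^sup>+x. ennreal (norm (f x) powr p * w x) \<partial>lebesgue) < \<infinity>"
  by (auto simp: Lp_norm_def epowr_def less_top)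

lemma Lp_norm_le_iff:
  assumes "1 < p" "0 \<le> M"
  shows "Lp_norm p w f \<le> ennreal M \<longleftrightarrow> (\<integral>\<^sup>+x. ennreal (norm (f x) powr p * w x) \<partial>lebesgue) \<le> ennreal (M powr p)"
proof (cases "\<integral>\<^sup>+x. ennreal (norm (f x) powr p * w x) \<partial>lebesgue")
  case (real r)
  have "r powr (1 / p) \<le> M \<longleftrightarrow> r \<le> M powr p"
  proof
    assume "r powr (1 / p) \<le> M"
    then have "(r powr (1 / p)) powr p \<le> M powr p" using assms by (intro powr_mono2) auto
    then show "r \<le> M powr p" using assms real by (simp add: powr_powr)
  next
    assume "r \<le> M powr p"
    then have "r powr (1 / p) \<le> (M powr p) powr (1 / p)" using assms real by (intro powr_mono2) auto
    then show "r powr (1 / p) \<le> M" using assms by (simp add: powr_powr)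
  qed
  then show ?thesis using real assms by (simp add: Lp_norm_def epowr_def)
qed (simp add: Lp_norm_def epowr_def top_unique)

lemma Lp_iff:
  "f \<in> Lp p w \<longleftrightarrow> f \<in> borel_measurable lebesgue \<and> (\<integral>\<^sup>+x. ennreal (norm (f x) powr p * w x) \<partial>lebesgue) < \<infinity>"
  by (simp only: Lp_def mem_Collect_eq Lp_norm_finite_iff)

lemma op_domainI: "w \<in> Ap p \<Longrightarrow> f \<in> Lp p w \<Longrightarrow> f \<in> op_domain p"
  by (auto simp: op_domain_def)

lemma nn_integral_norm_scale:
  fixes f :: "'a::euclidean_space \<Rightarrow> 'k::{real_normed_field, second_countable_topology}"
  assumes [measurable]: "f \<in> borel_measurable lebesgue" "w \<in> borel_measurable lebesgue" and "0 \<le> c"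
  shows "(\<integral>\<^sup>+x. ennreal ((c * norm (f x)) powr p * w x) \<partial>lebesgue)
    = ennreal (c powr p) * (\<integral>\<^sup>+x. ennreal (norm (f x) powr p * w x) \<partial>lebesgue)"
proof -
  have "(\<integral>\<^sup>+x. ennreal ((c * norm (f x)) powr p * w x) \<partial>lebesgue)
      = (\<integral>\<^sup>+x. ennreal (c powr p) * ennreal (norm (f x) powr p * w x) \<partial>lebesgue)"
    using assms(3) by (intro nn_integral_cong) (simp add: powr_mult mult.assoc ennreal_mult')
  then show ?thesis by (simp add: nn_integral_cmult)
qed

text \<open>Homogeneity carries the bound from the unit ball to the whole space. As \<open>T\<close>
  need not be additive, a function of norm 0 is treated by scaling as well: all its multiples lie in
  the unit ball.\<close>

lemma op_norm_bound:
  fixes T :: "(real ^ 'n::finite \<Rightarrow> 'k::{real_normed_field, second_countable_topology}) \<Rightarrow> real ^ 'n \<Rightarrow> 'k"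
  assumes p: "1 < p" and T: "sublinear_operator p T" and w: "w \<in> Ap p"
    and M: "op_norm p w T \<le> ennreal M" "0 \<le> M" and f: "f \<in> Lp p w"
  shows "(\<integral>\<^sup>+x. ennreal (norm (T f x) powr p * w x) \<partial>lebesgue)
    \<le> ennreal (M powr p) * (\<integral>\<^sup>+x. ennreal (norm (f x) powr p * w x) \<partial>lebesgue)"
proof -
  note [measurable] = Ap_measurable[OF w]
  have fm [measurable]: "f \<in> borel_measurable lebesgue" using f by (simp add: Lp_iff)
  have fd: "f \<in> op_domain p" using op_domainI[OF w f] .
  have Tm [measurable]: "T f \<in> borel_measurable lebesgue"
    using T fd by (simp add: sublinear_operator_def)
  define N where "N = (\<integral>\<^sup>+x. ennreal (norm (T f x) powr p * w x) \<partial>lebesgue)"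
  obtain n where n: "(\<integral>\<^sup>+x. ennreal (norm (f x) powr p * w x) \<partial>lebesgue) = ennreal n" "0 \<le> n"
    using f unfolding Lp_iff by (cases "\<integral>\<^sup>+x. ennreal (norm (f x) powr p * w x) \<partial>lebesgue") auto
  have key: "ennreal (c powr p) * N \<le> ennreal (M powr p)" if c: "0 < c" "c powr p * n \<le> 1" for c
  proof -
    define g where "g x = of_real c * f x" for x
    have gm: "g \<in> borel_measurable lebesgue" unfolding g_def by measurable
    have gn: "norm (g x) = c * norm (f x)" for x using c by (simp add: g_def norm_mult)
    have gN: "(\<integral>\<^sup>+x. ennreal (norm (g x) powr p * w x) \<partial>lebesgue) = ennreal (c powr p * n)"
      unfolding gn using c n by (subst nn_integral_norm_scale) (auto simp: ennreal_mult)
    have g: "g \<in> Lp p w" using gm gN by (simp add: Lp_iff)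
    have "Lp_norm p w g \<le> ennreal 1"
      using c gN p by (subst Lp_norm_le_iff) (auto intro: ennreal_leI)
    then have "Lp_norm p w (T g) \<le> op_norm p w T"
      unfolding op_norm_def using g by (intro SUP_upper) auto
    then have "Lp_norm p w (T g) \<le> ennreal M" using M by simp
    then have le: "(\<integral>\<^sup>+x. ennreal (norm (T g x) powr p * w x) \<partial>lebesgue) \<le> ennreal (M powr p)"
      using p M by (simp add: Lp_norm_le_iff)
    have "AE x in lebesgue. norm (T g x) = norm (of_real c :: 'k) * norm (T f x)"
      using T fd op_domainI[OF w g] unfolding sublinear_operator_def g_def by blast
    then have "(\<integral>\<^sup>+x. ennreal (norm (T g x) powr p * w x) \<partial>lebesgue)
        = (\<integral>\<^sup>+x. ennreal ((c * norm (T f x)) powr p * w x) \<partial>lebesgue)"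
      using c by (intro nn_integral_cong_AE) (auto elim!: eventually_mono)
    also have "\<dots> = ennreal (c powr p) * N" unfolding N_def using c by (intro nn_integral_norm_scale) auto
    finally show ?thesis using le by simp
  qed
  have "N \<noteq> \<infinity>"
  proof
    assume N: "N = \<infinity>"
    \<comment> \<open>Dividing by \<open>1 + n\<close> instead of \<open>n\<close> gives an
      admissible scaling also when \<open>n\<close> is 0.\<close>
    define c where "c = (1 / (1 + n)) powr (1 / p)"
    have c: "0 < c" "c powr p = 1 / (1 + n)" using n p by (auto simp: c_def powr_powr)
    then have "c powr p * n \<le> 1" using n by (simp add: divide_le_eq_1)
    then have "ennreal (c powr p) * N \<le> ennreal (M powr p)" using c by (intro key) auto
    then show False using N c n by (simp add: ennreal_mult_top top_unique)
  qed
  then obtain t where t: "N = ennreal t" "0 \<le> t" by (cases N) auto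
  have "t \<le> M powr p * n"
  proof (cases "n = 0")
    case True
    have "y * t \<le> M powr p" if "0 < y" for y
    proof -
      have "(y powr (1 / p)) powr p = y" using that p by (simp add: powr_powr)
      then have "ennreal y * N \<le> ennreal (M powr p)" using key[of "y powr (1 / p)"] that True by simp
      then show ?thesis using t that by (simp flip: ennreal_mult)
    qed
    \<comment> \<open>For positive \<open>t\<close> this choice of \<open>y\<close> would give
      \<open>M powr p + 1 \<le> M powr p\<close>.\<close>
    from this[of "(M powr p + 1) / t"] have "t = 0"
      using t by (cases "t = 0") (auto simp: add_nonneg_pos)
    then show ?thesis using True by simp
  next
    case False
    then have n0: "0 < n" using n by simp
    then have "((1 / n) powr (1 / p)) powr p = 1 / n" using p by (simp add: powr_powr)
    then have "ennreal (1 / n) * N \<le> ennreal (M powr p)" using key[of "(1 / n) powr (1 / p)"] n0 by simp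
    then have "ennreal ((1 / n) * t) \<le> ennreal (M powr p)" using t n0 by (subst ennreal_mult) auto
    then have "(1 / n) * t \<le> M powr p" by (subst (asm) ennreal_le_iff) auto
    then show ?thesis using n0 by (simp add: field_simps)
  qed
  then have "ennreal t \<le> ennreal (M powr p * n)" by (rule ennreal_leI)
  then show ?thesis unfolding N_def[symmetric] t n using n by (simp add: ennreal_mult)
qed

text \<open>For each \<open>s\<close> the function \<open>f\<close> is split as \<open>f0 + f1\<close> so that \<open>A0 |f0|^p w0 + s A1 |f1|^p w1\<close> is
  pointwise minimal. Since \<open>kfun\<close> is the exact minimum, no constant is lost when the resulting
  inequality is integrated against \<open>s^(-\<theta>-1) ds\<close>.\<close>

lemma sublinear_interpolation:
  fixes T :: "(real ^ 'n::finite \<Rightarrow> 'k::{real_normed_field, second_countable_topology}) \<Rightarrow> real ^ 'n \<Rightarrow> 'k"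
  assumes p: "1 < p" and T: "sublinear_operator p T" and \<theta>: "0 < \<theta>" "\<theta> < 1"
    and w0: "w0 \<in> Ap p" and w1: "w1 \<in> Ap p" and w: "w \<in> Ap p"
    and weq: "\<And>x. w x = w0 x powr (1 - \<theta>) * w1 x powr \<theta>"
    and A0: "0 < A0" "\<And>f. f \<in> Lp p w0 \<Longrightarrow> (\<integral>\<^sup>+x. ennreal (norm (T f x) powr p * w0 x) \<partial>lebesgue)
      \<le> ennreal A0 * (\<integral>\<^sup>+x. ennreal (norm (f x) powr p * w0 x) \<partial>lebesgue)"
    and A1: "0 < A1" "\<And>f. f \<in> Lp p w1 \<Longrightarrow> (\<integral>\<^sup>+x. ennreal (norm (T f x) powr p * w1 x) \<partial>lebesgue)
      \<le> ennreal A1 * (\<integral>\<^sup>+x. ennreal (norm (f x) powr p * w1 x) \<partial>lebesgue)"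
    and f: "f \<in> Lp p w"
  shows "(\<integral>\<^sup>+x. ennreal (norm (T f x) powr p * w x) \<partial>lebesgue)
    \<le> ennreal (A0 powr (1 - \<theta>) * A1 powr \<theta>) * (\<integral>\<^sup>+x. ennreal (norm (f x) powr p * w x) \<partial>lebesgue)"
proof -
  note [measurable] = Ap_measurable[OF w0] Ap_measurable[OF w1] Ap_measurable[OF w]
  have w0p: "0 < w0 x" and w1p: "0 < w1 x" and wp: "0 < w x" for x
    using Ap_pos w0 w1 w by blast+
  have fm [measurable]: "f \<in> borel_measurable lebesgue" using f by (simp add: Lp_iff)
  have Tm [measurable]: "T g \<in> borel_measurable lebesgue" if "g \<in> op_domain p" for g
    using T that by (simp add: sublinear_operator_def)
  have fd: "f \<in> op_domain p" using op_domainI[OF w f] .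
  note Tfm [measurable] = Tm[OF fd]
  define L where "L s = (\<integral>\<^sup>+x. ennreal (norm (T f x) powr p * kfun p (w0 x) (s * w1 x)) \<partial>lebesgue)" for s
  \<comment> \<open>The constants are absorbed into the weights, so that integration in
    \<open>s\<close> returns their geometric mean together with that of the weights.\<close>
  define R where "R s = (\<integral>\<^sup>+x. ennreal (norm (f x) powr p * kfun p (A0 * w0 x) (s * (A1 * w1 x))) \<partial>lebesgue)" for s
  have gm: "(A0 * w0 x) powr (1 - \<theta>) * (A1 * w1 x) powr \<theta> = A0 powr (1 - \<theta>) * A1 powr \<theta> * w x" for x
    using A0(1) A1(1) w0p[of x] w1p[of x] by (simp add: powr_mult weq mult_ac)
  have LR: "L s \<le> R s" if s: "0 < s" for s
  proof -
    \<comment> \<open>The splitting is optimal for the right-hand side \<open>R s\<close>; on the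
      left any splitting is allowed, since \<open>kfun\<close> is a lower bound for all of
      them.\<close>
    define a where "a x = ksplit p (A0 * w0 x) (s * (A1 * w1 x))" for x
    have am [measurable]: "a \<in> borel_measurable lebesgue" unfolding a_def by measurable
    have pos: "0 < A0 * w0 x" "0 < s * (A1 * w1 x)" for x using A0(1) A1(1) w0p w1p s by auto
    have a01: "0 < a x" "a x < 1" for x unfolding a_def using ksplit_bounds[OF pos[of x]] by auto
    define f0 where "f0 x = of_real (a x) * f x" for x
    define f1 where "f1 x = of_real (1 - a x) * f x" for x
    have fm01 [measurable]: "f0 \<in> borel_measurable lebesgue" "f1 \<in> borel_measurable lebesgue"
      unfolding f0_def f1_def by measurable
    have n0: "norm (f0 x) powr p = norm (f x) powr p * a x powr p"
      and n1: "norm (f1 x) powr p = norm (f x) powr p * (1 - a x) powr p" for x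
    proof -
      have "norm (f0 x) = norm (f x) * a x" using a01[of x] by (simp add: f0_def norm_mult)
      then show "norm (f0 x) powr p = norm (f x) powr p * a x powr p"
        using a01[of x] by (simp add: powr_mult)
      have "norm (of_real (1 - a x) :: 'k) = 1 - a x" using a01[of x] by (simp only: norm_of_real)
      then have "norm (f1 x) = norm (f x) * (1 - a x)" by (simp add: f1_def norm_mult)
      then show "norm (f1 x) powr p = norm (f x) powr p * (1 - a x) powr p"
        using a01[of x] by (simp add: powr_mult)
    qed
    have Rsplit: "ennreal A0 * (\<integral>\<^sup>+x. ennreal (norm (f0 x) powr p * w0 x) \<partial>lebesgue)
        + ennreal (s * A1) * (\<integral>\<^sup>+x. ennreal (norm (f1 x) powr p * w1 x) \<partial>lebesgue) = R s"
    proof -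
      have "ennreal A0 * (\<integral>\<^sup>+x. ennreal (norm (f0 x) powr p * w0 x) \<partial>lebesgue)
        + ennreal (s * A1) * (\<integral>\<^sup>+x. ennreal (norm (f1 x) powr p * w1 x) \<partial>lebesgue)
        = (\<integral>\<^sup>+x. ennreal A0 * ennreal (norm (f0 x) powr p * w0 x) + ennreal (s * A1) * ennreal (norm (f1 x) powr p * w1 x) \<partial>lebesgue)"
        by (simp add: nn_integral_add nn_integral_cmult)
      also have "\<dots> = R s" unfolding R_def
      proof (rule nn_integral_cong)
        fix x
        have "ennreal A0 * ennreal (norm (f0 x) powr p * w0 x) + ennreal (s * A1) * ennreal (norm (f1 x) powr p * w1 x)
          = ennreal (A0 * (norm (f0 x) powr p * w0 x) + s * A1 * (norm (f1 x) powr p * w1 x))"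
          using A0(1) A1(1) s w0p[of x] w1p[of x] by (simp add: ennreal_mult ennreal_plus less_imp_le)
        also have "A0 * (norm (f0 x) powr p * w0 x) + s * A1 * (norm (f1 x) powr p * w1 x)
          = norm (f x) powr p * (a x powr p * (A0 * w0 x) + (1 - a x) powr p * (s * (A1 * w1 x)))"
          unfolding n0 n1 by (simp add: algebra_simps)
        also have "a x powr p * (A0 * w0 x) + (1 - a x) powr p * (s * (A1 * w1 x)) = kfun p (A0 * w0 x) (s * (A1 * w1 x))"
          unfolding a_def by (rule kfun_attained[OF p pos])
        finally show "ennreal A0 * ennreal (norm (f0 x) powr p * w0 x) + ennreal (s * A1) * ennreal (norm (f1 x) powr p * w1 x)
          = ennreal (norm (f x) powr p * kfun p (A0 * w0 x) (s * (A1 * w1 x)))" .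
      qed
      finally show ?thesis .
    qed
    \<comment> \<open>\<open>f\<close> is only known to lie in the middle space. Finiteness of
      \<open>R s\<close> puts \<open>f0\<close> and \<open>f1\<close> into the endpoint spaces,
      hence into the domain of \<open>T\<close> and within reach of the bounds \<open>A0\<close> and
      \<open>A1\<close>.\<close>
    have Rfin: "R s < \<infinity>"
    proof -
      define C where "C = A0 powr (1 - \<theta>) * A1 powr \<theta> * s powr \<theta>"
      have "R s \<le> (\<integral>\<^sup>+x. ennreal C * ennreal (norm (f x) powr p * w x) \<partial>lebesgue)"
        unfolding R_def
      proof (rule nn_integral_mono)
        fix x
        have "kfun p (A0 * w0 x) (s * (A1 * w1 x)) \<le> (A0 * w0 x) powr (1 - \<theta>) * (s * (A1 * w1 x)) powr \<theta>"
          by (rule kfun_le_geometric_mean[OF p pos \<theta>])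
        also have "\<dots> = s powr \<theta> * ((A0 * w0 x) powr (1 - \<theta>) * (A1 * w1 x) powr \<theta>)"
          using s A1(1) w1p[of x] by (simp add: powr_mult mult_ac)
        also have "\<dots> = C * w x" unfolding gm C_def by (simp add: mult_ac)
        finally have "norm (f x) powr p * kfun p (A0 * w0 x) (s * (A1 * w1 x)) \<le> norm (f x) powr p * (C * w x)"
          by (rule mult_left_mono) simp
        then show "ennreal (norm (f x) powr p * kfun p (A0 * w0 x) (s * (A1 * w1 x))) \<le> ennreal C * ennreal (norm (f x) powr p * w x)"
          using wp[of x] by (simp add: C_def mult_ac flip: ennreal_mult)
      qed
      also have "\<dots> = ennreal C * (\<integral>\<^sup>+x. ennreal (norm (f x) powr p * w x) \<partial>lebesgue)"
        by (rule nn_integral_cmult) measurable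
      also have "\<dots> < \<infinity>" using f by (simp add: Lp_iff ennreal_mult_less_top)
      finally show ?thesis .
    qed
    have "ennreal A0 * (\<integral>\<^sup>+x. ennreal (norm (f0 x) powr p * w0 x) \<partial>lebesgue) < \<infinity>"
      "ennreal (s * A1) * (\<integral>\<^sup>+x. ennreal (norm (f1 x) powr p * w1 x) \<partial>lebesgue) < \<infinity>"
      using Rfin unfolding Rsplit[symmetric] by simp_all
    moreover have "ennreal A0 \<noteq> 0" "ennreal (s * A1) \<noteq> 0" using A0(1) A1(1) s by auto
    ultimately have f0: "f0 \<in> Lp p w0" and f1: "f1 \<in> Lp p w1"
      unfolding Lp_iff by (auto simp: ennreal_mult_less_top)
    have fsum: "f = (\<lambda>x. f0 x + f1 x)" by (auto simp: f0_def f1_def fun_eq_iff algebra_simps)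
    have d01: "f0 \<in> op_domain p" "f1 \<in> op_domain p" using op_domainI w0 w1 f0 f1 by blast+
    note [measurable] = Tm[OF d01(1)] Tm[OF d01(2)]
    have "AE x in lebesgue. norm (T (\<lambda>x. f0 x + f1 x) x) \<le> norm (T f0 x) + norm (T f1 x)"
      using T d01 fd unfolding sublinear_operator_def fsum by blast
    then have sub: "AE x in lebesgue. norm (T f x) \<le> norm (T f0 x) + norm (T f1 x)"
      using fsum by simp
    have "L s \<le> (\<integral>\<^sup>+x. ennreal (norm (T f0 x) powr p * w0 x) + ennreal s * ennreal (norm (T f1 x) powr p * w1 x) \<partial>lebesgue)"
      unfolding L_def
    proof (rule nn_integral_mono_AE, use sub in eventually_elim)
      case (elim x)
      have "norm (T f x) powr p * kfun p (w0 x) (s * w1 x) \<le> norm (T f0 x) powr p * w0 x + norm (T f1 x) powr p * (s * w1 x)"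
        using w1p[of x] s elim by (intro kfun_le[OF p w0p]) auto
      then have "ennreal (norm (T f x) powr p * kfun p (w0 x) (s * w1 x))
          \<le> ennreal (norm (T f0 x) powr p * w0 x + s * (norm (T f1 x) powr p * w1 x))"
        by (intro ennreal_leI) (simp add: mult_ac)
      then show ?case using w0p[of x] w1p[of x] s by (simp add: ennreal_mult ennreal_plus less_imp_le)
    qed
    also have "\<dots> = (\<integral>\<^sup>+x. ennreal (norm (T f0 x) powr p * w0 x) \<partial>lebesgue) + ennreal s * (\<integral>\<^sup>+x. ennreal (norm (T f1 x) powr p * w1 x) \<partial>lebesgue)"
      by (simp add: nn_integral_add nn_integral_cmult)
    also have "\<dots> \<le> ennreal A0 * (\<integral>\<^sup>+x. ennreal (norm (f0 x) powr p * w0 x) \<partial>lebesgue)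
        + ennreal s * (ennreal A1 * (\<integral>\<^sup>+x. ennreal (norm (f1 x) powr p * w1 x) \<partial>lebesgue))"
      by (intro add_mono mult_left_mono A0(2)[OF f0] A1(2)[OF f1]) auto
    also have "\<dots> = R s" unfolding Rsplit[symmetric] using s A1(1) by (simp add: ennreal_mult mult.assoc)
    finally show ?thesis .
  qed
  have "kconst p \<theta> * (\<integral>\<^sup>+x. ennreal (norm (T f x) powr p * w x) \<partial>lebesgue)
      = (\<integral>\<^sup>+s\<in>{0<..}. ennreal (s powr (- \<theta> - 1)) * L s \<partial>lborel)"
    unfolding L_def weq by (rule nn_integral_kfun_swap[symmetric]) (use p w0p w1p in auto)
  also have "\<dots> \<le> (\<integral>\<^sup>+s\<in>{0<..}. ennreal (s powr (- \<theta> - 1)) * R s \<partial>lborel)"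
    by (rule nn_integral_mono) (auto simp: indicator_def intro!: mult_left_mono LR)
  also have "\<dots> = kconst p \<theta> * (\<integral>\<^sup>+x. ennreal (norm (f x) powr p * ((A0 * w0 x) powr (1 - \<theta>) * (A1 * w1 x) powr \<theta>)) \<partial>lebesgue)"
    unfolding R_def by (rule nn_integral_kfun_swap) (use p w0p w1p A0(1) A1(1) in auto)
  also have "(\<integral>\<^sup>+x. ennreal (norm (f x) powr p * ((A0 * w0 x) powr (1 - \<theta>) * (A1 * w1 x) powr \<theta>)) \<partial>lebesgue)
      = ennreal (A0 powr (1 - \<theta>) * A1 powr \<theta>) * (\<integral>\<^sup>+x. ennreal (norm (f x) powr p * w x) \<partial>lebesgue)"
  proof -
    have "ennreal (norm (f x) powr p * ((A0 * w0 x) powr (1 - \<theta>) * (A1 * w1 x) powr \<theta>))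
        = ennreal (A0 powr (1 - \<theta>) * A1 powr \<theta>) * ennreal (norm (f x) powr p * w x)" for x
      unfolding gm using wp[of x] by (subst ennreal_mult[symmetric]) (auto simp: mult_ac)
    then show ?thesis by (simp only:) (rule nn_integral_cmult, measurable)
  qed
  finally show ?thesis
    using kconst_pos[of p \<theta>] kconst_finite[OF p \<theta>] by (simp add: ennreal_mult_le_mult_iff)
qed

text \<open>\<open>M0\<close> and \<open>M1\<close> are positive upper bounds instead of the norms
  themselves because they multiply the weights inside \<open>kfun\<close>, which is handled for
  positive arguments.\<close>

lemma op_norm_interpolation:
  fixes T :: "(real ^ 'n::finite \<Rightarrow> 'k::{real_normed_field, second_countable_topology}) \<Rightarrow> real ^ 'n \<Rightarrow> 'k"
  assumes p: "1 < p" and T: "sublinear_operator p T" and \<theta>: "0 < \<theta>" "\<theta> < 1"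
    and w: "w0 \<in> Ap p" "w1 \<in> Ap p" "w \<in> Ap p" "\<And>x. w x = w0 x powr (1 - \<theta>) * w1 x powr \<theta>"
    and M: "0 < M0" "0 < M1" "op_norm p w0 T \<le> ennreal M0" "op_norm p w1 T \<le> ennreal M1"
  shows "op_norm p w T \<le> ennreal (M0 powr (1 - \<theta>) * M1 powr \<theta>)"
  unfolding op_norm_def
proof (rule SUP_least)
  define M where "M = M0 powr (1 - \<theta>) * M1 powr \<theta>"
  fix f :: "real ^ 'n \<Rightarrow> 'k" assume "f \<in> {f \<in> Lp p w. Lp_norm p w f \<le> 1}"
  then have f: "f \<in> Lp p w" and "Lp_norm p w f \<le> ennreal 1" by auto
  then have f1: "(\<integral>\<^sup>+x. ennreal (norm (f x) powr p * w x) \<partial>lebesgue) \<le> 1"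
    using p by (subst (asm) Lp_norm_le_iff) auto
  have "(\<integral>\<^sup>+x. ennreal (norm (T f x) powr p * w x) \<partial>lebesgue)
      \<le> ennreal ((M0 powr p) powr (1 - \<theta>) * (M1 powr p) powr \<theta>) * (\<integral>\<^sup>+x. ennreal (norm (f x) powr p * w x) \<partial>lebesgue)"
    using M by (intro sublinear_interpolation[OF p T \<theta> w _ _ _ _ f] op_norm_bound[OF p T]) (auto simp: w less_imp_le)
  also have "\<dots> \<le> ennreal ((M0 powr p) powr (1 - \<theta>) * (M1 powr p) powr \<theta>) * 1"
    by (intro mult_left_mono f1) simp
  also have "(M0 powr p) powr (1 - \<theta>) * (M1 powr p) powr \<theta> = M powr p"
    using M by (simp add: M_def powr_mult powr_powr mult_ac)
  finally show "Lp_norm p w (T f) \<le> ennreal (M0 powr (1 - \<theta>) * M1 powr \<theta>)"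
    unfolding M_def[symmetric] using p M by (subst Lp_norm_le_iff) (auto simp: M_def)
qed

section \<open>Continuity of the operator norm\<close>

theorem theorem1:
  fixes T :: "(real ^ 'n::finite \<Rightarrow> 'k::{real_normed_field, second_countable_topology})
                \<Rightarrow> real ^ 'n \<Rightarrow> 'k"
    and F :: "real \<Rightarrow> real"
    and p :: real
    and w0 :: "real ^ 'n \<Rightarrow> real"
  assumes "1 < p"
    and "sublinear_operator p T"
    and "\<forall>t\<ge>1. 0 < F t"
    and "mono_on {1..} F"
    and "\<forall>w\<in>Ap p. op_norm p w T \<le> ennreal (F (enn2real (Ap_char p w)))"
    and "w0 \<in> Ap p"
  shows "\<forall>\<eta>>0. \<exists>\<delta>>0. \<forall>w\<in>Ap p. d_star w w0 < ennreal \<delta> \<longrightarrow>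
           \<bar>enn2real (op_norm p w T) - enn2real (op_norm p w0 T)\<bar> < \<eta>"
proof (intro allI impI)
  fix \<eta> :: real assume \<eta>: "0 < \<eta>"
  note p = assms(1) and T = assms(2) and w0 = assms(6)
  note [measurable] = Ap_measurable[OF w0]
  have w0p: "0 < w0 x" for x by (rule Ap_pos[OF w0])
  obtain e K0 where e: "0 < e" and pert: "\<And>h. h \<in> borel_measurable lebesgue \<Longrightarrow> bmo_norm h \<le> ennreal e \<Longrightarrow>
    (\<lambda>x. w0 x * exp (h x)) \<in> Ap p \<and> Ap_char p (\<lambda>x. w0 x * exp (h x)) \<le> ennreal K0"
    by (rule Ap_perturbation[OF p w0]) (rule that)
  \<comment> \<open>The maximum keeps the argument in the range where \<open>F\<close> is monotone
    and positive.\<close>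
  define K where "K = F (max 1 K0)"
  have K: "0 < K" using assms(3) by (simp add: K_def)
  have bound: "op_norm p (\<lambda>x. w0 x * exp (h x)) T \<le> ennreal K"
    if h: "h \<in> borel_measurable lebesgue" "bmo_norm h \<le> ennreal e" for h
  proof -
    let ?w = "\<lambda>x. w0 x * exp (h x)"
    have w: "?w \<in> Ap p" "Ap_char p ?w \<le> ennreal (max 1 K0)"
      using pert[OF h] by (auto elim!: order_trans intro!: ennreal_leI)
    have "enn2real (Ap_char p ?w) \<le> enn2real (ennreal (max 1 K0))"
      using w(2) by (intro enn2real_mono) auto
    then have "F (enn2real (Ap_char p ?w)) \<le> K"
      unfolding K_def using Ap_char_ge_1[OF p w(1)] by (intro mono_onD[OF assms(4)]) auto
    then show ?thesis using assms(5) w(1) by (meson ennreal_leI order_trans)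
  qed
  \<comment> \<open>The margin added to a norm that may be 0. It costs at most half of \<eta>, and
    being at most \<open>K\<close> it keeps the enlarged norm below \<open>2 * K\<close>.\<close>
  define \<kappa> where "\<kappa> = min K (\<eta> / 2)"
  have \<kappa>: "0 < \<kappa>" "\<kappa> \<le> K" "\<kappa> \<le> \<eta> / 2" using K \<eta> by (auto simp: \<kappa>_def)
  \<comment> \<open>As \<theta> tends to 0 the power tends to 1. The factor \<open>2 * K\<close>
    bounds the enlarged norm, so this is the other half of the error.\<close>
  obtain \<theta> where \<theta>: "0 < \<theta>" "\<theta> < 1" "2 * K * ((K / \<kappa>) powr \<theta> - 1) < \<eta> / 2"
  proof -
    have "((\<lambda>\<theta>. 2 * K * ((K / \<kappa>) powr \<theta> - 1)) \<longlongrightarrow> 2 * K * ((K / \<kappa>) powr 0 - 1)) (at_right 0)"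
      using K \<kappa> by (intro tendsto_intros) auto
    then have "\<forall>\<^sub>F \<theta> in at_right 0. 2 * K * ((K / \<kappa>) powr \<theta> - 1) < \<eta> / 2"
      using K \<kappa> \<eta> by (intro order_tendstoD(2)) auto
    moreover have "\<forall>\<^sub>F \<theta>::real in at_right 0. 0 < \<theta> \<and> \<theta> < 1"
      using eventually_at_right_real[of 0 "1::real"] by auto
    ultimately have "\<forall>\<^sub>F \<theta> in at_right 0. 0 < \<theta> \<and> \<theta> < 1 \<and> 2 * K * ((K / \<kappa>) powr \<theta> - 1) < \<eta> / 2"
      by eventually_elim simp
    then show thesis using that eventually_happens'[OF trivial_limit_at_right_real] by blast
  qed
  define \<rho> where "\<rho> = (K / \<kappa>) powr \<theta>"
  have \<rho>: "1 \<le> \<rho>" using K \<kappa> \<theta> by (auto simp: \<rho>_def intro!: ge_one_powr_ge_zero)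
  have close: "enn2real (op_norm p wa T) - enn2real (op_norm p wb T) < \<eta>"
    if w: "wb \<in> Ap p" "wc \<in> Ap p" "wa \<in> Ap p" "\<And>x. wa x = wb x powr (1 - \<theta>) * wc x powr \<theta>"
      and b: "op_norm p wb T \<le> ennreal K" and c: "op_norm p wc T \<le> ennreal K" for wa wb wc
  proof -
    define y where "y = enn2real (op_norm p wb T)"
    have y: "op_norm p wb T = ennreal y" "0 \<le> y" "y \<le> K"
      using b K by (auto simp: y_def le_ennreal_iff)
    have "op_norm p wb T \<le> ennreal (y + \<kappa>)" unfolding y(1) using \<kappa> by (intro ennreal_leI) simp
    then have "op_norm p wa T \<le> ennreal ((y + \<kappa>) powr (1 - \<theta>) * K powr \<theta>)"
      using c K y \<kappa> by (intro op_norm_interpolation[OF p T \<theta>(1,2) w]) auto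
    then have "enn2real (op_norm p wa T) \<le> (y + \<kappa>) powr (1 - \<theta>) * K powr \<theta>"
      by (intro enn2real_leI) auto
    also have "\<dots> = (y + \<kappa>) * (K / (y + \<kappa>)) powr \<theta>"
      using y \<kappa> K by (simp add: powr_diff powr_divide)
    \<comment> \<open>The ratio \<open>K / (y + \<kappa>)\<close> is at most
      \<open>K / \<kappa>\<close> whatever the norm \<open>y\<close> is, so \<theta> can be fixed
      before the weights are known.\<close>
    also have "\<dots> \<le> (y + \<kappa>) * \<rho>"
      unfolding \<rho>_def using y \<kappa> K \<theta> by (intro mult_left_mono powr_mono2 divide_left_mono) auto
    finally have "enn2real (op_norm p wa T) - y \<le> (y + \<kappa>) * (\<rho> - 1) + \<kappa>" by (simp add: algebra_simps)
    also have "(y + \<kappa>) * (\<rho> - 1) \<le> 2 * K * (\<rho> - 1)"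
      using y \<kappa> \<rho> by (intro mult_right_mono) auto
    finally show ?thesis using \<theta>(3) \<kappa>(3) unfolding \<rho>_def y_def by linarith
  qed
  show "\<exists>\<delta>>0. \<forall>w\<in>Ap p. d_star w w0 < ennreal \<delta> \<longrightarrow>
           \<bar>enn2real (op_norm p w T) - enn2real (op_norm p w0 T)\<bar> < \<eta>"
  \<comment> \<open>The exponents used are multiples of \<open>h\<close> by factors of size at most
    \<open>1 / \<theta>\<close>; this radius brings all of them within \<open>e\<close> in
    BMO.\<close>
  proof (intro exI[of _ "e * \<theta>"] conjI ballI impI)
    show "0 < e * \<theta>" using e \<theta> by simp
    fix w assume w: "w \<in> Ap p" and d: "d_star w w0 < ennreal (e * \<theta>)"
    note [measurable] = Ap_measurable[OF w]
    have wp: "0 < w x" for x by (rule Ap_pos[OF w])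
    define h where "h x = ln (w x) - ln (w0 x)" for x
    have hm [measurable]: "h \<in> borel_measurable lebesgue" unfolding h_def by measurable
    have h: "bmo_norm h \<le> ennreal (e * \<theta>)" using d by (simp add: d_star_def h_def[abs_def])
    have wh: "w x = w0 x * exp (h x)" for x
      using wp[of x] w0p[of x] by (simp add: h_def exp_diff)
    have scaled: "bmo_norm (\<lambda>x. k * h x) \<le> ennreal e" if k: "\<bar>k\<bar> \<le> 1 / \<theta>" for k
    proof -
      have "bmo_norm (\<lambda>x. k * h x) = ennreal \<bar>k\<bar> * bmo_norm h" by (rule bmo_norm_cmult[OF hm])
      also have "\<dots> \<le> ennreal (1 / \<theta>) * ennreal (e * \<theta>)"
        by (intro mult_mono h ennreal_leI k) auto
      also have "\<dots> = ennreal e" using \<theta> e by (simp flip: ennreal_mult)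
      finally show ?thesis .
    qed
    have pert': "(\<lambda>x. w0 x * exp (k * h x)) \<in> Ap p \<and> op_norm p (\<lambda>x. w0 x * exp (k * h x)) T \<le> ennreal K"
      if "\<bar>k\<bar> \<le> 1 / \<theta>" for k
      using pert[OF _ scaled[OF that]] bound[OF _ scaled[OF that]] by simp
    have comb: "(a * exp u) powr (1 - \<theta>) * (a * exp v) powr \<theta> = a * exp ((1 - \<theta>) * u + \<theta> * v)"
      if "0 < a" for a u v :: real
    proof -
      have "(a * exp u) powr (1 - \<theta>) * (a * exp v) powr \<theta>
          = (a powr (1 - \<theta>) * a powr \<theta>) * (exp ((1 - \<theta>) * u) * exp (\<theta> * v))"
        using that by (simp add: powr_mult exp_powr_real mult_ac)
      then show ?thesis using that by (simp add: exp_add flip: powr_add)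
    qed
    have th1: "1 \<le> 1 / \<theta>" using \<theta> by simp
    have weq: "w = (\<lambda>x. w0 x * exp (1 * h x))" by (rule ext) (simp only: wh mult_1)
    \<comment> \<open>The factors 1 and 0 give \<open>w\<close> and \<open>w0\<close>. Both norms
      are thereby finite, so \<open>enn2real\<close> does not take its default value at
      infinity.\<close>
    have bw: "op_norm p w T \<le> ennreal K"
      unfolding weq using pert'[of 1] th1 by simp
    have bw0: "op_norm p w0 T \<le> ennreal K"
      using pert'[of 0] \<theta> by simp
    have "enn2real (op_norm p w T) - enn2real (op_norm p w0 T) < \<eta>"
    proof (rule close)
      show "w x = w0 x powr (1 - \<theta>) * (w0 x * exp (1 / \<theta> * h x)) powr \<theta>" for x
        using comb[OF w0p[of x], of 0 "1 / \<theta> * h x"] wh[of x] \<theta> by simp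
    qed (use w w0 bw bw0 pert'[of "1 / \<theta>"] \<theta> in auto)
    moreover have "enn2real (op_norm p w0 T) - enn2real (op_norm p w T) < \<eta>"
    proof (rule close)
      \<comment> \<open>The factor is chosen to cancel \<open>(1 - \<theta>) * h\<close>, which is
        what \<open>w\<close> contributes to the exponent.\<close>
      show "w0 x = w x powr (1 - \<theta>) * (w0 x * exp (- ((1 - \<theta>) / \<theta>) * h x)) powr \<theta>" for x
        using comb[OF w0p[of x], of "h x" "- ((1 - \<theta>) / \<theta>) * h x"] wh[of x] \<theta> by simp
    qed (use w w0 bw bw0 pert'[of "- ((1 - \<theta>) / \<theta>)"] \<theta> in \<open>auto simp: divide_right_mono\<close>)
    ultimately show "\<bar>enn2real (op_norm p w T) - enn2real (op_norm p w0 T)\<bar> < \<eta>" by linarith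
  qed
qed

end
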